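(* Let $X$ be a Stone vector lattice of continuous functions $f\colon\Omega\to\mathbb{R}$ on a topological space $\Omega$, and let $\phi\colon X\to\mathbb{R}\cup\{+\infty\}$ be an increasing convex functional satisfying condition (A) or condition (B) stated in the context. Then $$\phi(f)=\max_{\mu\in ca^+(X)}\big(\langle f,\mu\rangle-\phi^*_X(\mu)\big)\quad\text{for all } f\in I(\phi)$$ (in particular, the maximum is attained).
   Context: Inequalities between functions are pointwise. For a non-empty set $\Omega$, a linear subspace $X$ of $\mathbb{R}^\Omega$ is a *Stone vector lattice* if for all $f,g\in X$ the pointwise minima $f\wedge g$ and $f\wedge 1$ belong to $X$. $X^+:=\{g\in X: g\ge 0\}$. $\sigma(X)$ is the smallest $\sigma$-algebra on $\Omega$ making all $f\in X$ measurable (with respect to the Borel $\sigma$-algebra on $\mathbb{R}$). $\langle f,\mu\rangle:=\int_\Omega f\,d\mu$. $ca^+(X)$ is the set of all (countably additive, nonnegative) measures $\mu$ on $\sigma(X)$ with $\langle f,\mu\rangle<+\infty$ for every $f\in X^+$. A functional $\phi\colon X\to\mathbb{R}\cup\{+\infty\}$ is *increasing convex* if it is convex and $\phi(f)\ge\phi(g)$ whenever $f\ge g$. $\mathrm{dom}\,\phi:=\{f\in X:\phi(f)<+\infty\}$, and $I(\phi)$ is the algebraic interior of $\mathrm{dom}\,\phi$: the set of all $f\in\mathrm{dom}\,\phi$ such that for every $g\in X$ there is an $\varepsilon>0$ with $f+\lambda g\in\mathrm{dom}\,\phi$ for all $0\le\lambda\le\varepsilon$. The convex conjugate is $\phi^*_X(\mu):=\sup_{f\in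 X}(\langle f,\mu\rangle-\phi(f))$ for $\mu\in ca^+(X)$. $f_n\downarrow f$ means pointwise convergence from above (i.e. $(f_n)$ is decreasing and converges pointwise to $f$). A set is relatively compact if its closure is compact. $\mathbb{R}_+^\Omega$ is the set of functions $\Omega\to[0,\infty)$; a function $\hat\phi\colon Y\to\mathbb{R}$ on a convex set $Y\subseteq\mathbb{R}_+^\Omega$ is increasing if $\hat\phi(h_1)\ge\hat\phi(h_2)$ for $h_1\ge h_2$ in $Y$. **Condition (A).** For all $f\in I(\phi)$ and every sequence $(f_n)$ in $X^+$ satisfying $f_n\downarrow 0$, there exists a constant $\varepsilon>0$ such that for each constant $\delta>0$ there are $m\in\mathbb{N}$, $g\in\mathbb{R}_+^\Omega$ and an increasing convex function $\hat\phi\colon Y\to\mathbb{R}$ on a convex subset $Y\subseteq\mathbb{R}_+^\Omega$ containing $\{0,\ f_m g,\ (\varepsilon-g)^+,\ \varepsilon f_n: n\ge m\}$ so that (i) $\{g<\varepsilon\}$ is relatively compact, (ii) $\hat\phi(f_m g)\le\delta$, and (iii) $\hat\phi(\varepsilon f_n)\ge\phi(f+\varepsilon f_n)-\phi(f)$ for all $n\ge m$. **Condition (B).** For all $f\in I(\phi)$ and every sequence $(f_n)$ in $X^+$ satisfying $f_n\downarrow 0$, there exist functions $g,g_1,g_2,\dots$ in $\mathbb{R}_+^\Omega$ and numbers $m,m_1,m_2,\dots$ in $\mathbb{N}=\{1,2,\dots\}$ together with an increasing convex function $\hat\phi\colon Y\to\mathbb{R}$ on a convex subset $Y\subseteq\mathbb{R}_+^\Omega$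 containing $\{0,\ f_n/m,\ g,\ g_n: n\ge m\}$ so that (i) $\{f_m>g/n\}$ is relatively compact and contained in $\{m_n g_n\ge 1\}$ for all $n\ge m$, (ii) $\hat\phi(0)=0$, and (iii) $\hat\phi(f_n/m)\ge\phi(f+f_n/m)-\phi(f)$ for all $n\ge m$. *)

theory Defs
  imports "HOL-Analysis.Analysis" "HOL-Library.Function_Algebras"
begin

text \<open>
  Real-valued functions form a real vector space under the pointwise operations. Addition,
  multiplication, \<open>0\<close>, \<open>1\<close>, \<open>\<le>\<close> and \<open>inf\<close> are the pointwise ones of the library; the instance below
  adds scalar multiplication, so that \<^const>\<open>convex\<close> and \<^const>\<open>convex_on\<close> apply to functions.
\<close>

instantiation "fun" :: (type, real_vector) real_vector
begin

definition scaleR_fun_def: "c *\<^sub>R f = (\<lambda>x. c *\<^sub>R f x)"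

instance
  by standard (simp_all add: scaleR_fun_def fun_eq_iff scaleR_add_right scaleR_add_left)

end

lemma scaleR_fun_apply [simp]: "(c *\<^sub>R f) x = c *\<^sub>R f x"
  by (simp add: scaleR_fun_def)

definition stone_vector_lattice :: "('a \<Rightarrow> real) set \<Rightarrow> bool" where
  "stone_vector_lattice X \<longleftrightarrow>
     subspace X \<and> (\<forall>f\<in>X. \<forall>g\<in>X. inf f g \<in> X) \<and> (\<forall>f\<in>X. inf f 1 \<in> X)"

definition nonneg_part :: "('a \<Rightarrow> real) set \<Rightarrow> ('a \<Rightarrow> real) set" where
  "nonneg_part X = {f \<in> X. 0 \<le> f}"

definition sigma_gen :: "('a \<Rightarrow> real) set \<Rightarrow> 'a measure" where
  "sigma_gen X = sigma UNIV {f -` B | f B. f \<in> X \<and> B \<in> sets borel}"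

text \<open>
  Only the integrals of the functions in \<open>X\<close> have to be finite; the measure itself may be infinite.
  For such a measure every \<open>f \<in> X\<close> is integrable, since its positive and negative parts lie in \<open>X\<close>,
  so the Bochner integrals used below are genuine.
\<close>

definition ca_plus :: "('a \<Rightarrow> real) set \<Rightarrow> 'a measure set" where
  "ca_plus X = {\<mu>. sets \<mu> = sets (sigma_gen X) \<and>
     (\<forall>f\<in>nonneg_part X. (\<integral>\<^sup>+x. ennreal (f x) \<partial>\<mu>) < \<infinity>)}"

text \<open>
  A functional \<open>X \<rightarrow> \<real> \<union> {+\<infinity>}\<close> is a total \<^typ>\<open>ereal\<close>-valued function that avoids \<open>-\<infinity>\<close> on \<open>X\<close>;
  its values outside \<open>X\<close> are never used. In \<^typ>\<open>ereal\<close>, \<open>0 * \<infinity> = 0\<close>, so the convexity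
  inequality is harmless when one of the weights vanishes.
\<close>

definition increasing_convex :: "('a \<Rightarrow> real) set \<Rightarrow> (('a \<Rightarrow> real) \<Rightarrow> ereal) \<Rightarrow> bool" where
  "increasing_convex X \<phi> \<longleftrightarrow>
     (\<forall>f\<in>X. \<phi> f \<noteq> -\<infinity>) \<and> mono_on X \<phi> \<and>
     (\<forall>f\<in>X. \<forall>g\<in>X. \<forall>u\<ge>0. \<forall>v\<ge>0. u + v = 1 \<longrightarrow>
        \<phi> (u *\<^sub>R f + v *\<^sub>R g) \<le> ereal u * \<phi> f + ereal v * \<phi> g)"

definition dom_of :: "('a \<Rightarrow> real) set \<Rightarrow> (('a \<Rightarrow> real) \<Rightarrow> ereal) \<Rightarrow> ('a \<Rightarrow> real) set" where
  "dom_of X \<phi> = {f \<in> X. \<phi> f < \<infinity>}"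

definition alg_interior_dom :: "('a \<Rightarrow> real) set \<Rightarrow> (('a \<Rightarrow> real) \<Rightarrow> ereal) \<Rightarrow> ('a \<Rightarrow> real) set" where
  "alg_interior_dom X \<phi> =
     {f \<in> dom_of X \<phi>. \<forall>g\<in>X. \<exists>\<epsilon>>0. \<forall>t. 0 \<le> t \<and> t \<le> \<epsilon> \<longrightarrow> f + t *\<^sub>R g \<in> dom_of X \<phi>}"

definition conjugate :: "('a \<Rightarrow> real) set \<Rightarrow> (('a \<Rightarrow> real) \<Rightarrow> ereal) \<Rightarrow> 'a measure \<Rightarrow> ereal" where
  "conjugate X \<phi> \<mu> = (SUP f\<in>X. ereal (integral\<^sup>L \<mu> f) - \<phi> f)"

text \<open>Sequences are indexed by \<open>1, 2, \<dots>\<close>; the entry at index \<open>0\<close> is unconstrained and never used.\<close>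

definition decreases_to_zero_in :: "('a \<Rightarrow> real) set \<Rightarrow> (nat \<Rightarrow> 'a \<Rightarrow> real) \<Rightarrow> bool" where
  "decreases_to_zero_in S F \<longleftrightarrow>
     (\<forall>n\<ge>1. F n \<in> S \<and> F (Suc n) \<le> F n) \<and> (\<forall>x. (\<lambda>n. F n x) \<longlonglongrightarrow> 0)"

definition relatively_compact :: "'a::topological_space set \<Rightarrow> bool" where
  "relatively_compact S \<longleftrightarrow> compact (closure S)"

text \<open>\<^const>\<open>convex_on\<close> includes the convexity of the set \<open>Y\<close>.\<close>

definition condition_A ::
  "('a::topological_space \<Rightarrow> real) set \<Rightarrow> (('a \<Rightarrow> real) \<Rightarrow> ereal) \<Rightarrow> bool" where
  "condition_A X \<phi> \<longleftrightarrow>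
     (\<forall>f\<in>alg_interior_dom X \<phi>. \<forall>F. decreases_to_zero_in (nonneg_part X) F \<longrightarrow>
       (\<exists>\<epsilon>>0. \<forall>\<delta>>0. \<exists>m\<ge>1. \<exists>g\<ge>0. \<exists>Y (\<psi> :: ('a \<Rightarrow> real) \<Rightarrow> real).
          Y \<subseteq> {h. 0 \<le> h} \<and> convex_on Y \<psi> \<and> mono_on Y \<psi> \<and>
          {0, F m * g, (\<lambda>x. max 0 (\<epsilon> - g x))} \<union> {\<epsilon> *\<^sub>R F n | n. n \<ge> m} \<subseteq> Y \<and>
          relatively_compact {x. g x < \<epsilon>} \<and>
          \<psi> (F m * g) \<le> \<delta> \<and>
          (\<forall>n\<ge>m. ereal (\<psi> (\<epsilon> *\<^sub>R F n)) \<ge> \<phi> (f + \<epsilon> *\<^sub>R F n) - \<phi> f)))"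

text \<open>Here \<open>G n\<close> and \<open>k n\<close> are the \<open>g\<^sub>n\<close> and \<open>m\<^sub>n\<close> of the condition.\<close>

definition condition_B ::
  "('a::topological_space \<Rightarrow> real) set \<Rightarrow> (('a \<Rightarrow> real) \<Rightarrow> ereal) \<Rightarrow> bool" where
  "condition_B X \<phi> \<longleftrightarrow>
     (\<forall>f\<in>alg_interior_dom X \<phi>. \<forall>F. decreases_to_zero_in (nonneg_part X) F \<longrightarrow>
       (\<exists>(g :: 'a \<Rightarrow> real) (G :: nat \<Rightarrow> 'a \<Rightarrow> real) (m :: nat) (k :: nat \<Rightarrow> nat)
          Y (\<psi> :: ('a \<Rightarrow> real) \<Rightarrow> real).
          0 \<le> g \<and> (\<forall>n\<ge>1. 0 \<le> G n) \<and> m \<ge> 1 \<and> (\<forall>n\<ge>1. k n \<ge> 1) \<and>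
          Y \<subseteq> {h. 0 \<le> h} \<and> convex_on Y \<psi> \<and> mono_on Y \<psi> \<and>
          {0, g} \<union> {(1 / real m) *\<^sub>R F n | n. n \<ge> m} \<union> {G n | n. n \<ge> m} \<subseteq> Y \<and>
          (\<forall>n\<ge>m. relatively_compact {x. F m x > g x / real n} \<and>
                  {x. F m x > g x / real n} \<subseteq> {x. real (k n) * G n x \<ge> 1}) \<and>
          \<psi> 0 = 0 \<and>
          (\<forall>n\<ge>m. ereal (\<psi> ((1 / real m) *\<^sub>R F n)) \<ge> \<phi> (f + (1 / real m) *\<^sub>R F n) - \<phi> f)))"

end

theory Submission
  imports Defs
begin

text \<open>
  At an algebraic interior point \<open>f\<close> of its domain the convex functional \<open>\<phi>\<close> has finite directional
  derivatives, which form a sublinear functional on \<open>X\<close>. By the Hahn--Banach theorem some linear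
  functional \<open>L\<close> lies below it, so that \<open>\<phi> f + L h \<le> \<phi> (f + h)\<close> for all \<open>h \<in> X\<close>
  (\<open>convex_subgradient_on\<close>). As \<open>\<phi>\<close> is increasing, \<open>L\<close> is positive. If \<open>L\<close> is the integral with
  respect to some \<open>\<mu> \<in> ca_plus X\<close>, the inequality says precisely that the supremum defining the
  conjugate at \<open>\<mu>\<close> is attained at \<open>f\<close>, which is the asserted equality. The inequality for the other
  measures is immediate from the definition of the conjugate.

  By the Daniell--Stone theorem (\<open>integral_representing\<close>), a positive linear \<open>L\<close> is such an integral
  once \<open>L (F n) \<longlonglongrightarrow> 0\<close> for every sequence \<open>F n\<close> in \<open>X\<close> decreasing pointwise to \<open>0\<close>. Only here do
  the two conditions enter. Both provide an increasing convex \<open>\<psi>\<close> with \<open>L (c F n) \<le> \<psi> (c F n)\<close>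
  for some constant \<open>c > 0\<close> and all large \<open>n\<close>. By Dini's theorem \<open>F n\<close> is small on the compact closure that the
  condition supplies, and off this set it is controlled by \<open>g\<close>. So \<open>c F n\<close>, for large \<open>n\<close>, lies below
  a convex combination of functions at which \<open>\<psi>\<close> is controlled; see \<open>eventually_small_A\<close> and
  \<open>eventually_small_B\<close>. Under the first condition this argument needs \<open>F n \<le> (1 - s) F m\<close>
  for some \<open>s > 0\<close> and all large \<open>n\<close>; hence the condition is applied to the sequence
  \<open>(1 + 1/n) F n\<close> instead.
\<close>

section \<open>Linear functionals below a sublinear or convex one\<close>

text \<open>
  Subadditive and positively homogeneous on \<open>X\<close>. One inequality suffices for homogeneity: applied to
  \<open>1/c\<close> it gives the converse, and the two cases \<open>c = 2\<close> and \<open>c = 1/2\<close> give \<open>p 0 = 0\<close>.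
\<close>

definition sublinear_on :: "'v::real_vector set \<Rightarrow> ('v \<Rightarrow> real) \<Rightarrow> bool" where
  "sublinear_on X p \<longleftrightarrow> (\<forall>x\<in>X. \<forall>y\<in>X. p (x + y) \<le> p x + p y) \<and>
     (\<forall>x\<in>X. \<forall>c>0. p (c *\<^sub>R x) \<le> c * p x)"

lemma le_cINF_add:
  fixes f :: "'i \<Rightarrow> real" and g :: "'j \<Rightarrow> real"
  assumes "A \<noteq> {}" "B \<noteq> {}" and le: "\<And>a b. a \<in> A \<Longrightarrow> b \<in> B \<Longrightarrow> z \<le> f a + g b"
  shows "z \<le> (INF a\<in>A. f a) + (INF b\<in>B. g b)"
proof -
  have "z - (INF b\<in>B. g b) \<le> f a" if "a \<in> A" for a
  proof -
    have "z - f a \<le> (INF b\<in>B. g b)"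
      using le[OF that] by (intro cINF_greatest[OF \<open>B \<noteq> {}\<close>]) (simp add: algebra_simps)
    then show ?thesis by simp
  qed
  then have "z - (INF b\<in>B. g b) \<le> (INF a\<in>A. f a)"
    by (intro cINF_greatest[OF \<open>A \<noteq> {}\<close>])
  then show ?thesis by simp
qed

context
  fixes X :: "'v::real_vector set"
  assumes sub: "subspace X"
begin

lemma sublinear_on_scale:
  assumes "sublinear_on X p" "x \<in> X" "c \<ge> 0"
  shows "p (c *\<^sub>R x) = c * p x"
proof (cases "c = 0")
  case True
  have "p (d *\<^sub>R 0) \<le> d * p 0" if "d > 0" for d
    using assms(1) subspace_0[OF sub] that unfolding sublinear_on_def by blast
  from this[of 2] this[of "1/2"] have "p 0 = 0" by simp
  with True show ?thesis by simp
next
  case False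
  with \<open>c \<ge> 0\<close> have c: "c > 0" by simp
  have "c *\<^sub>R x \<in> X" using assms(2) subspace_scale[OF sub] by simp
  then have "p ((1/c) *\<^sub>R (c *\<^sub>R x)) \<le> (1/c) * p (c *\<^sub>R x)"
    using assms(1) c unfolding sublinear_on_def by (metis zero_less_divide_1_iff)
  then have "c * p x \<le> p (c *\<^sub>R x)"
    using c by (simp add: field_simps)
  moreover have "p (c *\<^sub>R x) \<le> c * p x"
    using assms c unfolding sublinear_on_def by simp
  ultimately show ?thesis by simp
qed

lemma sublinear_on_zero: "sublinear_on X p \<Longrightarrow> p 0 = 0"
  using sublinear_on_scale[of p 0 0] subspace_0[OF sub] by simp

lemma sublinear_on_add:
  "sublinear_on X p \<Longrightarrow> x \<in> X \<Longrightarrow> y \<in> X \<Longrightarrow> p (x + y) \<le> p x + p y"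
  by (simp add: sublinear_on_def)

lemma sublinear_on_ge_minus:
  assumes "sublinear_on X q" "x \<in> X"
  shows "- q (- x) \<le> q x"
  using sublinear_on_add[OF assms, of "- x"] sublinear_on_zero[OF assms(1)]
    subspace_neg[OF sub assms(2)] by simp

lemma minimal_sublinear_below:
  assumes p: "sublinear_on X p"
  obtains m where "sublinear_on X m" "\<And>x. x \<in> X \<Longrightarrow> m x \<le> p x"
    "\<And>q x. sublinear_on X q \<Longrightarrow> (\<And>x. x \<in> X \<Longrightarrow> q x \<le> m x) \<Longrightarrow> x \<in> X \<Longrightarrow> q x = m x"
proof -
  \<comment> \<open>The value \<open>0\<close> outside \<open>X\<close> makes the pointwise order see the values on \<open>X\<close> only.\<close>
  define S where "S = {q. sublinear_on X q \<and> (\<forall>x\<in>X. q x \<le> p x) \<and> (\<forall>x. x \<notin> X \<longrightarrow> q x = 0)}"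
  define P where "P = (\<lambda>q r :: 'v \<Rightarrow> real. r \<le> q)"
  have po: "partial_order_on S (relation_of P S)"
    by (rule partial_order_on_relation_ofI) (auto simp: P_def)
  have restr: "(\<lambda>x. if x \<in> X then q x else 0) \<in> S"
    if "sublinear_on X q" "\<And>x. x \<in> X \<Longrightarrow> q x \<le> p x" for q
    using that subspace_add[OF sub] subspace_scale[OF sub]
    by (auto simp: S_def sublinear_on_def)
  have "\<exists>u\<in>S. \<forall>a\<in>C. P a u" if C: "C \<in> Chains (relation_of P S)" for C
  proof (cases "C = {}")
    case True
    then show ?thesis using restr[OF p] by auto
  next
    case False
    have CS: "q \<in> S" if "q \<in> C" for q
      using C that by (auto simp: Chains_def relation_of_def)
    have lin: "a \<le> b \<or> b \<le> a" if "a \<in> C" "b \<in> C" for a b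
      using C that by (auto simp: Chains_def relation_of_def P_def)
    have below: "- p (- x) \<le> q x" if "q \<in> C" "x \<in> X" for q x
    proof -
      have "- q (- x) \<le> q x" "q (- x) \<le> p (- x)"
        using sublinear_on_ge_minus[of q x] CS[OF \<open>q \<in> C\<close>] that subspace_neg[OF sub]
        by (auto simp: S_def)
      then show ?thesis by simp
    qed
    then have bdd: "bdd_below ((\<lambda>q. q x) ` C)" if "x \<in> X" for x
      using that by (auto intro!: bdd_belowI)
    define u where "u = (\<lambda>x. INF q\<in>C. q x)"
    have ule: "u x \<le> q x" if "q \<in> C" "x \<in> X" for q x
      unfolding u_def using bdd that by (auto intro!: cINF_lower)
    have "u (x + y) \<le> u x + u y" if xy: "x \<in> X" "y \<in> X" for x y
      unfolding u_def
    proof (rule le_cINF_add[OF False False])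
      fix a b assume ab: "a \<in> C" "b \<in> C"
      have "\<exists>c\<in>C. c \<le> a \<and> c \<le> b" using lin[OF ab] ab by auto
      then obtain c where c: "c \<in> C" "c \<le> a" "c \<le> b" by auto
      have "(INF q\<in>C. q (x + y)) \<le> c (x + y)"
        using ule[OF c(1), of "x + y"] subspace_add[OF sub xy] by (simp add: u_def)
      also have "\<dots> \<le> c x + c y"
        using CS[OF c(1)] xy sublinear_on_add by (auto simp: S_def)
      also have "\<dots> \<le> a x + b y" using c by (auto simp: le_fun_def intro: add_mono)
      finally show "(INF q\<in>C. q (x + y)) \<le> a x + b y" .
    qed
    moreover have "u (c *\<^sub>R x) \<le> c * u x" if x: "x \<in> X" "c > 0" for x c
    proof -
      have "u (c *\<^sub>R x) / c \<le> q x" if "q \<in> C" for q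
      proof -
        have "u (c *\<^sub>R x) \<le> c * q x"
          using ule[OF that, of "c *\<^sub>R x"] CS[OF that] sublinear_on_scale[of q x c] x
            subspace_scale[OF sub] by (auto simp: S_def)
        then show ?thesis using x by (simp add: field_simps)
      qed
      then have "u (c *\<^sub>R x) / c \<le> u x"
        unfolding u_def[THEN fun_cong, of x] by (intro cINF_greatest[OF False])
      then show ?thesis using x by (simp add: field_simps)
    qed
    ultimately have "sublinear_on X u" by (auto simp: sublinear_on_def)
    moreover have "u x \<le> p x" if "x \<in> X" for x
    proof -
      obtain q where "q \<in> C" using False by auto
      then show ?thesis using ule[of q x] CS[of q] that by (force simp: S_def)
    qed
    ultimately have "(\<lambda>x. if x \<in> X then u x else 0) \<in> S" by (rule restr)
    moreover have "P a (\<lambda>x. if x \<in> X then u x else 0)" if "a \<in> C" for a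
      using ule[OF that] CS[OF that] by (auto simp: P_def le_fun_def S_def)
    ultimately show ?thesis by blast
  qed
  from predicate_Zorn[OF po this]
  obtain m where m: "m \<in> S" "\<And>a. a \<in> S \<Longrightarrow> a \<le> m \<Longrightarrow> a = m"
    unfolding P_def by blast
  show ?thesis
  proof (rule that[of m])
    fix q x assume q: "sublinear_on X q" "\<And>x. x \<in> X \<Longrightarrow> q x \<le> m x" and "x \<in> X"
    let ?q = "\<lambda>x. if x \<in> X then q x else 0"
    have "?q \<in> S"
      using q m(1) by (intro restr) (force simp: S_def)+
    moreover have "?q \<le> m"
      using q m(1) by (auto simp: S_def le_fun_def)
    ultimately have "?q = m" by (rule m(2))
    from fun_cong[OF this, of x] show "q x = m x" using \<open>x \<in> X\<close> by simp
  qed (use m(1) in \<open>auto simp: S_def\<close>)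
qed

text \<open>
  A minimal sublinear functional \<open>m\<close> is linear: for fixed \<open>y\<close>, the functional
  \<open>q x = (INF t\<ge>0. m (x + t y) - t m y)\<close> is again sublinear and below \<open>m\<close>, hence equal to \<open>m\<close>, and the
  value at \<open>t = 1\<close> yields \<open>m x + m y \<le> m (x + y)\<close>.
\<close>

theorem hahn_banach_on:
  assumes p: "sublinear_on X p"
  shows "\<exists>L. (\<forall>x\<in>X. \<forall>y\<in>X. L (x + y) = L x + L y) \<and>
    (\<forall>x\<in>X. \<forall>c. L (c *\<^sub>R x) = c * L x) \<and> (\<forall>x\<in>X. L x \<le> p x)"
proof -
  obtain m where m: "sublinear_on X m" and mp: "\<And>x. x \<in> X \<Longrightarrow> m x \<le> p x"
    and min: "\<And>q x. sublinear_on X q \<Longrightarrow> (\<And>x. x \<in> X \<Longrightarrow> q x \<le> m x) \<Longrightarrow> x \<in> X \<Longrightarrow> q x = m x"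
    using minimal_sublinear_below[OF p] by blast
  note X = subspace_add[OF sub] subspace_scale[OF sub] subspace_neg[OF sub]
  have super: "m x + m y \<le> m (x + y)" if xy: "x \<in> X" "y \<in> X" for x y
  proof -
    define q where "q = (\<lambda>x. INF t\<in>{0::real..}. m (x + t *\<^sub>R y) - t * m y)"
    have "- m (- z) \<le> m (z + t *\<^sub>R y) - t * m y" if "z \<in> X" "t \<ge> 0" for z t
    proof -
      have "m ((z + t *\<^sub>R y) + (- z)) \<le> m (z + t *\<^sub>R y) + m (- z)"
        using that xy X by (intro sublinear_on_add[OF m]) auto
      then show ?thesis using sublinear_on_scale[OF m xy(2) that(2)] by simp
    qed
    then have "bdd_below ((\<lambda>t. m (z + t *\<^sub>R y) - t * m y) ` {0..})" if "z \<in> X" for z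
      using that by (auto intro!: bdd_belowI)
    then have qle: "q z \<le> m (z + t *\<^sub>R y) - t * m y" if "z \<in> X" "t \<ge> 0" for z t
      unfolding q_def using that by (intro cINF_lower) auto
    have "q (a + b) \<le> q a + q b" if ab: "a \<in> X" "b \<in> X" for a b
      unfolding q_def[THEN fun_cong, of a] q_def[THEN fun_cong, of b]
    proof (rule le_cINF_add)
      fix s t :: real assume st: "s \<in> {0..}" "t \<in> {0..}"
      have "q (a + b) \<le> m (a + b + (s + t) *\<^sub>R y) - (s + t) * m y"
        using st ab X by (intro qle) auto
      also have "a + b + (s + t) *\<^sub>R y = (a + s *\<^sub>R y) + (b + t *\<^sub>R y)"
        by (simp add: algebra_simps)
      also have "m \<dots> \<le> m (a + s *\<^sub>R y) + m (b + t *\<^sub>R y)"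
        using st ab X xy by (intro sublinear_on_add[OF m]) auto
      finally show "q (a + b) \<le> (m (a + s *\<^sub>R y) - s * m y) + (m (b + t *\<^sub>R y) - t * m y)"
        by (simp add: algebra_simps)
    qed auto
    moreover have "q (c *\<^sub>R a) \<le> c * q a" if a: "a \<in> X" "c > 0" for a c
    proof -
      have "q (c *\<^sub>R a) / c \<le> m (a + t *\<^sub>R y) - t * m y" if t: "t \<in> {0..}" for t
      proof -
        have "q (c *\<^sub>R a) \<le> m (c *\<^sub>R a + (c * t) *\<^sub>R y) - (c * t) * m y"
          using t a X by (intro qle) auto
        also have "c *\<^sub>R a + (c * t) *\<^sub>R y = c *\<^sub>R (a + t *\<^sub>R y)"
          by (simp add: algebra_simps)
        also have "m \<dots> = c * m (a + t *\<^sub>R y)"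
          using t a X xy by (intro sublinear_on_scale[OF m]) auto
        finally show ?thesis using a by (simp add: field_simps)
      qed
      then have "q (c *\<^sub>R a) / c \<le> q a"
        unfolding q_def[THEN fun_cong, of a] by (intro cINF_greatest) auto
      then show ?thesis using a by (simp add: field_simps)
    qed
    ultimately have "sublinear_on X q" by (auto simp: sublinear_on_def)
    moreover have "q z \<le> m z" if "z \<in> X" for z using qle[OF that, of 0] by simp
    ultimately have "q x = m x" using xy by (intro min) auto
    then show ?thesis using qle[OF xy(1), of 1] by simp
  qed
  have add: "m (x + y) = m x + m y" if "x \<in> X" "y \<in> X" for x y
    using super[OF that] sublinear_on_add[OF m that] by simp
  have neg: "m (- x) = - m x" if "x \<in> X" for x
    using add[of x "- x"] sublinear_on_zero[OF m] that X by simp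
  have "m (c *\<^sub>R x) = c * m x" if "x \<in> X" for c x
  proof (cases "c \<ge> 0")
    case True
    then show ?thesis using sublinear_on_scale[OF m that] by simp
  next
    case False
    then have "m ((- c) *\<^sub>R x) = - c * m x" by (intro sublinear_on_scale[OF m that]) simp
    moreover have "m ((- c) *\<^sub>R x) = - m (c *\<^sub>R x)" using neg[of "c *\<^sub>R x"] that X by simp
    ultimately show ?thesis by simp
  qed
  with add mp show ?thesis by blast
qed

text \<open>
  The directional derivative \<open>p h = (INF t. (\<phi> (f + t h) - \<phi> f) / t)\<close>, taken over those \<open>t > 0\<close> for
  which \<open>\<phi> (f + t h)\<close> is finite, is a finite sublinear functional.
\<close>

theorem convex_subgradient_on:
  fixes \<phi> :: "'v \<Rightarrow> ereal"
  assumes f: "f \<in> X" "\<phi> f = ereal r"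
    and not_MInf: "\<And>x. x \<in> X \<Longrightarrow> \<phi> x \<noteq> -\<infinity>"
    and convex: "\<And>x y u v. x \<in> X \<Longrightarrow> y \<in> X \<Longrightarrow> u \<ge> 0 \<Longrightarrow> v \<ge> 0 \<Longrightarrow> u + v = 1 \<Longrightarrow>
      \<phi> (u *\<^sub>R x + v *\<^sub>R y) \<le> ereal u * \<phi> x + ereal v * \<phi> y"
    and interior: "\<And>h. h \<in> X \<Longrightarrow> \<exists>t>0. \<phi> (f + t *\<^sub>R h) < \<infinity>"
  shows "\<exists>L. (\<forall>x\<in>X. \<forall>y\<in>X. L (x + y) = L x + L y) \<and>
    (\<forall>x\<in>X. \<forall>c. L (c *\<^sub>R x) = c * L x) \<and> (\<forall>h\<in>X. ereal (r + L h) \<le> \<phi> (f + h))"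
proof -
  note X = subspace_add[OF sub] subspace_scale[OF sub] subspace_neg[OF sub]
  define T where "T = (\<lambda>h. {t. t > 0 \<and> \<phi> (f + t *\<^sub>R h) < \<infinity>})"
  define D where "D = (\<lambda>h t. (real_of_ereal (\<phi> (f + t *\<^sub>R h)) - r) / t)"
  define p where "p = (\<lambda>h. INF t\<in>T h. D h t)"
  have T: "T h \<noteq> {}" if "h \<in> X" for h
    using interior[OF that] by (auto simp: T_def)
  have eq: "\<phi> (f + t *\<^sub>R h) = ereal (r + t * D h t)" if "h \<in> X" "t \<in> T h" for h t
    using that not_MInf[of "f + t *\<^sub>R h"] f X
    by (cases "\<phi> (f + t *\<^sub>R h)") (auto simp: T_def D_def)
  have key: "\<exists>t\<in>T (h + k). D (h + k) t \<le> D h s + D k s'"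
    if h: "h \<in> X" "s \<in> T h" and k: "k \<in> X" "s' \<in> T k" for h k s s'
  proof -
    have pos: "s > 0" "s' > 0" using h k by (auto simp: T_def)
    then have ne: "s + s' \<noteq> 0" by simp
    \<comment> \<open>With this step length, \<open>f + t (h + k)\<close> is the convex combination with weights \<open>u\<close>, \<open>v\<close> of
      \<open>f + s h\<close> and \<open>f + s' k\<close>.\<close>
    define t where "t = s * s' / (s + s')"
    define u v where "u = s' / (s + s')" and "v = s / (s + s')"
    have t: "t > 0" using pos by (simp add: t_def)
    have uv: "u \<ge> 0" "v \<ge> 0" "u * s = t" "v * s' = t"
      using pos by (simp_all add: u_def v_def t_def)
    have "u + v = (s' + s) / (s + s')" unfolding u_def v_def by (rule add_divide_distrib[symmetric])
    then have uv1: "u + v = 1" using ne by (simp add: add.commute)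
    have "f + t *\<^sub>R (h + k) = (u + v) *\<^sub>R f + (u * s) *\<^sub>R h + (v * s') *\<^sub>R k"
      unfolding uv uv1 by (simp add: algebra_simps)
    also have "\<dots> = u *\<^sub>R (f + s *\<^sub>R h) + v *\<^sub>R (f + s' *\<^sub>R k)"
      by (simp add: algebra_simps)
    also have "\<phi> \<dots> \<le> ereal u * \<phi> (f + s *\<^sub>R h) + ereal v * \<phi> (f + s' *\<^sub>R k)"
      by (intro convex uv uv1 X f h k)
    also have "\<dots> = ereal (u * (r + s * D h s) + v * (r + s' * D k s'))"
      using eq[OF h] eq[OF k] by simp
    also have "u * (r + s * D h s) + v * (r + s' * D k s') =
        (u + v) * r + (u * s) * D h s + (v * s') * D k s'"
      by (simp add: algebra_simps)
    also have "\<dots> = r + t * (D h s + D k s')"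
      unfolding uv uv1 by (simp add: algebra_simps)
    finally have le: "\<phi> (f + t *\<^sub>R (h + k)) \<le> ereal (r + t * (D h s + D k s'))" .
    then have tT: "t \<in> T (h + k)" using t by (auto simp: T_def intro: le_less_trans)
    from le have "t * D (h + k) t \<le> t * (D h s + D k s')"
      using eq[OF _ tT] h k X by simp
    then have "D (h + k) t \<le> D h s + D k s'" using t by (simp add: mult_le_cancel_left_pos)
    with tT show ?thesis by blast
  qed
  have bdd: "bdd_below (D h ` T h)" if h: "h \<in> X" for h
  proof -
    \<comment> \<open>The derivatives along \<open>h\<close> and \<open>- h\<close> have a nonnegative sum, as \<open>D 0 = 0\<close>.\<close>
    obtain s' where s': "s' \<in> T (- h)" using T X h by fastforce
    have "- D (- h) s' \<le> D h s" if s: "s \<in> T h" for s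
    proof -
      obtain t where "D (h + - h) t \<le> D h s + D (- h) s'"
        using key[OF h s _ s'] X h by blast
      then show ?thesis by (simp add: D_def f)
    qed
    then show ?thesis by (auto intro!: bdd_belowI)
  qed
  have p_le: "p h \<le> D h t" if "h \<in> X" "t \<in> T h" for h t
    unfolding p_def using bdd that by (auto intro: cINF_lower)
  have "p (h + k) \<le> p h + p k" if hk: "h \<in> X" "k \<in> X" for h k
    unfolding p_def[THEN fun_cong, of h] p_def[THEN fun_cong, of k]
  proof (rule le_cINF_add)
    fix s s' assume "s \<in> T h" "s' \<in> T k"
    then obtain t where "t \<in> T (h + k)" "D (h + k) t \<le> D h s + D k s'"
      using key hk by blast
    then show "p (h + k) \<le> D h s + D k s'"
      using p_le[of "h + k" t] hk X by force
  qed (use T hk in auto)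
  moreover have "p (c *\<^sub>R h) \<le> c * p h" if h: "h \<in> X" "c > 0" for c h
  proof -
    have "p (c *\<^sub>R h) / c \<le> D h t" if t: "t \<in> T h" for t
    proof -
      have "t / c \<in> T (c *\<^sub>R h)" "D (c *\<^sub>R h) (t / c) = c * D h t"
        using t h by (auto simp: T_def D_def)
      then have "p (c *\<^sub>R h) \<le> c * D h t"
        using p_le[of "c *\<^sub>R h" "t / c"] h X by auto
      then show ?thesis using h by (simp add: field_simps)
    qed
    then have "p (c *\<^sub>R h) / c \<le> p h"
      unfolding p_def[THEN fun_cong, of h] by (intro cINF_greatest T h)
    then show ?thesis using h by (simp add: field_simps)
  qed
  ultimately have "sublinear_on X p" by (auto simp: sublinear_on_def)
  from hahn_banach_on[OF this] obtain L
    where L: "\<forall>x\<in>X. \<forall>y\<in>X. L (x + y) = L x + L y" "\<forall>x\<in>X. \<forall>c. L (c *\<^sub>R x) = c * L x"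
      "\<forall>x\<in>X. L x \<le> p x"
    by blast
  have "ereal (r + L h) \<le> \<phi> (f + h)" if h: "h \<in> X" for h
  proof (cases "\<phi> (f + h) < \<infinity>")
    case True
    then have 1: "1 \<in> T h" by (simp add: T_def)
    then have "L h \<le> D h 1" using L(3) h p_le[OF h 1] by force
    then show ?thesis using eq[OF h 1] by simp
  qed auto
  with L(1,2) show ?thesis by blast
qed

end

section \<open>The Daniell--Stone representation\<close>

lemma stone_latticeD:
  assumes "stone_vector_lattice X"
  shows stone_add: "f \<in> X \<Longrightarrow> g \<in> X \<Longrightarrow> (\<lambda>x. f x + g x) \<in> X"
    and stone_scale: "f \<in> X \<Longrightarrow> (\<lambda>x. c * f x) \<in> X"
    and stone_zero: "(\<lambda>x. 0) \<in> X"
    and stone_min: "f \<in> X \<Longrightarrow> g \<in> X \<Longrightarrow> (\<lambda>x. min (f x) (g x)) \<in> X"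
    and stone_min_one: "f \<in> X \<Longrightarrow> (\<lambda>x. min (f x) 1) \<in> X"
proof -
  have sub: "subspace X" using assms by (simp add: stone_vector_lattice_def)
  show "f \<in> X \<Longrightarrow> g \<in> X \<Longrightarrow> (\<lambda>x. f x + g x) \<in> X"
    using subspace_add[OF sub] by (simp add: plus_fun_def)
  show "f \<in> X \<Longrightarrow> (\<lambda>x. c * f x) \<in> X"
    using subspace_scale[OF sub, of f c] by (simp add: scaleR_fun_def)
  show "(\<lambda>x. 0) \<in> X"
    using subspace_0[OF sub] by (simp add: zero_fun_def)
  have "inf f g = (\<lambda>x. min (f x) (g x))" "inf f 1 = (\<lambda>x. min (f x) 1)" for f g :: "'a \<Rightarrow> real"
    by (auto simp: inf_fun_def inf_min)
  then show "f \<in> X \<Longrightarrow> g \<in> X \<Longrightarrow> (\<lambda>x. min (f x) (g x)) \<in> X" "f \<in> X \<Longrightarrow> (\<lambda>x. min (f x) 1) \<in> X"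
    using assms by (metis stone_vector_lattice_def)+
qed

text \<open>
  Cutting \<open>y\<close> into layers of height \<open>h\<close>: the \<open>(j+1)\<close>-st layer is at most \<open>h\<close>, and nonzero only if
  \<open>y > j h\<close>; it equals \<open>h\<close> if \<open>y > (j+1) h\<close>. Both bounds result from summing over the layers.
\<close>

lemma slice_layers:
  fixes y h :: real
  assumes "0 \<le> y" "0 < h"
  shows "min y (real (Suc M) * h) - min y h \<le> (\<Sum>j<M. h * of_bool (y > real (Suc j) * h))"
    and "(\<Sum>j<M. h * of_bool (y > real (Suc j) * h)) \<le> y"
proof -
  have "(\<Sum>j<M. min y (real (Suc (Suc j)) * h) - min y (real (Suc j) * h))
      \<le> (\<Sum>j<M. h * of_bool (y > real (Suc j) * h))"
    using assms by (intro sum_mono) (auto simp: min_def algebra_simps)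
  then show "min y (real (Suc M) * h) - min y h \<le> (\<Sum>j<M. h * of_bool (y > real (Suc j) * h))"
    by (subst (asm) sum_lessThan_telescope) simp
  have "(\<Sum>j<M. h * of_bool (y > real (Suc j) * h))
      \<le> (\<Sum>j<M. min y (real (Suc j) * h) - min y (real j * h))"
    using assms by (intro sum_mono) (auto simp: min_def algebra_simps)
  also have "\<dots> \<le> y" using assms
    by (subst sum_lessThan_telescope) (auto simp: min_def)
  finally show "(\<Sum>j<M. h * of_bool (y > real (Suc j) * h)) \<le> y" .
qed

text \<open>
  A positive linear functional on a Stone vector lattice that is continuous along sequences
  decreasing pointwise to \<open>0\<close>. Such sequences are automatically nonnegative.
\<close>

locale daniell_functional =
  fixes X :: "('a \<Rightarrow> real) set" and L :: "('a \<Rightarrow> real) \<Rightarrow> real"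
  assumes stone: "stone_vector_lattice X"
    and L_add: "f \<in> X \<Longrightarrow> g \<in> X \<Longrightarrow> L (\<lambda>x. f x + g x) = L f + L g"
    and L_scale: "f \<in> X \<Longrightarrow> L (\<lambda>x. c * f x) = c * L f"
    and L_nonneg: "f \<in> X \<Longrightarrow> (\<And>x. 0 \<le> f x) \<Longrightarrow> 0 \<le> L f"
    and L_cont: "(\<And>n. F n \<in> X) \<Longrightarrow> (\<And>n x. F (Suc n) x \<le> F n x) \<Longrightarrow>
      (\<And>x. (\<lambda>n. F n x) \<longlonglongrightarrow> 0) \<Longrightarrow> (\<lambda>n. L (F n)) \<longlonglongrightarrow> 0"
begin

lemmas X_add = stone_add[OF stone]
  and X_scale = stone_scale[OF stone]
  and X_zero = stone_zero[OF stone]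
  and X_min = stone_min[OF stone]
  and X_min_one = stone_min_one[OF stone]

lemma X_diff: "f \<in> X \<Longrightarrow> g \<in> X \<Longrightarrow> (\<lambda>x. f x - g x) \<in> X"
  using X_add[of f "\<lambda>x. - 1 * g x"] X_scale[of g "-1"] by simp

lemma X_max: "f \<in> X \<Longrightarrow> g \<in> X \<Longrightarrow> (\<lambda>x. max (f x) (g x)) \<in> X"
proof -
  assume fg: "f \<in> X" "g \<in> X"
  have "(\<lambda>x. max (f x) (g x)) = (\<lambda>x. (f x + g x) - min (f x) (g x))"
    by (auto simp: max_def min_def)
  also have "\<dots> \<in> X"
    by (intro X_diff X_add X_min fg)
  finally show ?thesis .
qed

lemma X_sum: "(\<And>i. i \<in> I \<Longrightarrow> f i \<in> X) \<Longrightarrow> (\<lambda>x. \<Sum>i\<in>I. f i x) \<in> X"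
  by (induction I rule: infinite_finite_induct) (auto intro: X_zero X_add)

lemma X_min_const:
  assumes "f \<in> X" "c > 0"
  shows "(\<lambda>x. min (f x) c) \<in> X"
proof -
  have "(\<lambda>x. min (f x) c) = (\<lambda>x. c * min ((1/c) * f x) 1)"
    using assms(2) by (auto simp: min_def field_simps)
  also have "\<dots> \<in> X" by (intro X_scale X_min_one assms)
  finally show ?thesis .
qed

lemma L_diff: "f \<in> X \<Longrightarrow> g \<in> X \<Longrightarrow> L (\<lambda>x. f x - g x) = L f - L g"
  using L_add[of f "\<lambda>x. - 1 * g x"] X_scale[of g "-1"] L_scale[of g "-1"] by simp

lemma L_mono: "f \<in> X \<Longrightarrow> g \<in> X \<Longrightarrow> (\<And>x. f x \<le> g x) \<Longrightarrow> L f \<le> L g"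
  using L_nonneg[of "\<lambda>x. g x - f x"] L_diff[of g f] X_diff[of g f] by simp

lemma L_zero: "L (\<lambda>x. 0) = 0"
  using L_scale[OF X_zero, of 0] by simp

lemma L_sum: "(\<And>i. i \<in> I \<Longrightarrow> f i \<in> X) \<Longrightarrow> L (\<lambda>x. \<Sum>i\<in>I. f i x) = (\<Sum>i\<in>I. L (f i))"
proof (induction I rule: infinite_finite_induct)
  case (insert a I)
  then show ?case using L_add[of "f a" "\<lambda>x. \<Sum>i\<in>I. f i x"] X_sum[of I f] by simp
qed (auto simp: L_zero)

text \<open>
  If \<open>g\<close> lies below the pointwise supremum of the increasing sequence \<open>u\<close>, then \<open>g - min g (u n)\<close>
  decreases to \<open>0\<close>, and the continuity of \<open>L\<close> applies.
\<close>

lemma L_le_of_upper: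
  assumes g: "g \<in> X" and u: "\<And>n. u n \<in> X" "\<And>n x. u n x \<le> u (Suc n) x"
    and dom: "\<And>x c. c < g x \<Longrightarrow> \<exists>n. c < u n x"
    and bound: "\<And>n. L (u n) \<le> B"
  shows "L g \<le> B"
proof -
  define F where "F n x = g x - min (g x) (u n x)" for n x
  have mono: "u m x \<le> u n x" if "m \<le> n" for m n x
    using lift_Suc_mono_le[of "\<lambda>n. u n x", OF u(2) that] .
  have "(\<lambda>n. L (F n)) \<longlonglongrightarrow> 0"
  proof (rule L_cont)
    show "F n \<in> X" for n unfolding F_def by (intro X_diff X_min g u)
    show "F (Suc n) x \<le> F n x" for n x using u(2)[of n x] by (auto simp: F_def)
    show "(\<lambda>n. F n x) \<longlonglongrightarrow> 0" for x
    proof (rule LIMSEQ_I)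
      fix r :: real assume r: "0 < r"
      then obtain N where "g x - r < u N x" using dom[of "g x - r" x] by auto
      then have "g x - r < u n x" if "n \<ge> N" for n using mono[OF that, of x] by linarith
      then show "\<exists>N. \<forall>n\<ge>N. norm (F n x - 0) < r"
        using r by (intro exI[of _ N]) (auto simp: F_def min_def algebra_simps)
    qed
  qed
  then have "(\<lambda>n. L (F n) + B) \<longlonglongrightarrow> 0 + B" by (intro tendsto_intros)
  moreover have "L g \<le> L (F n) + B" for n
  proof -
    have "L (F n) = L g - L (\<lambda>x. min (g x) (u n x))"
      unfolding F_def by (intro L_diff X_min g u)
    moreover have "L (\<lambda>x. min (g x) (u n x)) \<le> L (u n)"
      by (intro L_mono X_min g u) auto
    ultimately show ?thesis using bound[of n] by simp
  qed
  ultimately show ?thesis using LIMSEQ_le_const by fastforce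
qed

text \<open>
  The increasing sequences of nonnegative functions in \<open>X\<close> whose pointwise supremum (possibly
  infinite) is at least \<open>1\<close> on \<open>A\<close>.
\<close>

definition covers :: "'a set \<Rightarrow> (nat \<Rightarrow> 'a \<Rightarrow> real) set" where
  "covers A = {u. (\<forall>n. u n \<in> X) \<and> (\<forall>n x. 0 \<le> u n x \<and> u n x \<le> u (Suc n) x) \<and>
     (\<forall>x\<in>A. \<forall>c<1. \<exists>n. c < u n x)}"

text \<open>
  The Daniell outer measure. It is infinite for sets that have no cover.
\<close>

definition outer :: "'a set \<Rightarrow> ennreal" where
  "outer A = (INF u\<in>covers A. SUP n. ennreal (L (u n)))"

lemma coversD:
  assumes "u \<in> covers A"
  shows "u n \<in> X" "0 \<le> u n x" "u n x \<le> u (Suc n) x" "m \<le> n \<Longrightarrow> u m x \<le> u n x"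
    "x \<in> A \<Longrightarrow> c < 1 \<Longrightarrow> \<exists>n. c < u n x" "0 \<le> L (u n)"
proof -
  show *: "u n \<in> X" "0 \<le> u n x" "u n x \<le> u (Suc n) x" "x \<in> A \<Longrightarrow> c < 1 \<Longrightarrow> \<exists>n. c < u n x" for n x
    using assms by (auto simp: covers_def)
  show "u m x \<le> u n x" if "m \<le> n" for x m n
    using lift_Suc_mono_le[of "\<lambda>n. u n x", OF *(3) that] .
  show "0 \<le> L (u n)" using * by (intro L_nonneg) auto
qed

lemma outer_lower: "u \<in> covers A \<Longrightarrow> (\<And>n. L (u n) \<le> B) \<Longrightarrow> outer A \<le> ennreal B"
  unfolding outer_def by (rule INF_lower2) (auto intro!: SUP_least ennreal_leI)

lemma outer_le_L:
  assumes "g \<in> X" "\<And>x. 0 \<le> g x" "\<And>x. x \<in> A \<Longrightarrow> 1 \<le> g x"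
  shows "outer A \<le> ennreal (L g)"
  using assms by (intro outer_lower[of "\<lambda>_. g"]) (force simp: covers_def)+

lemma L_le_outer:
  assumes g: "g \<in> X" "\<And>x. x \<in> A \<Longrightarrow> g x \<le> 1" "\<And>x. x \<notin> A \<Longrightarrow> g x \<le> 0"
  shows "ennreal (L g) \<le> outer A"
  unfolding outer_def
proof (rule INF_greatest)
  fix u assume u: "u \<in> covers A"
  show "ennreal (L g) \<le> (SUP n. ennreal (L (u n)))"
  proof (cases "SUP n. ennreal (L (u n))")
    case (real B)
    have "L (u n) \<le> B" for n
    proof -
      have "ennreal (L (u n)) \<le> ennreal B" unfolding real(2)[symmetric] by (rule SUP_upper) simp
      then show ?thesis using real(1) by (simp add: ennreal_le_iff)
    qed
    moreover have "\<exists>n. c < u n x" if "c < g x" for x c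
    proof (cases "x \<in> A")
      case True
      then show ?thesis using that g(2)[OF True] coversD(5)[OF u True, of c] by simp
    next
      case False
      then show ?thesis using that g(3)[OF False] coversD(2)[OF u, of 0 x]
        by (intro exI[of _ 0]) linarith
    qed
    ultimately have "L g \<le> B"
      using coversD[OF u] by (intro L_le_of_upper[OF g(1), of u]) auto
    then show ?thesis using real by (simp add: ennreal_leI)
  next
    case top
    show ?thesis unfolding top by (rule top_greatest)
  qed
qed

lemma outer_empty: "outer {} = 0"
  using outer_le_L[OF X_zero, of "{}"] by (simp add: L_zero)

lemma outer_mono: "A \<subseteq> B \<Longrightarrow> outer A \<le> outer B"
  unfolding outer_def by (rule INF_superset_mono) (auto simp: covers_def)

lemma outer_approx:
  assumes "outer A < \<infinity>" "e > 0"
  obtains u where "u \<in> covers A" "\<And>n. ennreal (L (u n)) \<le> outer A + ennreal e"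
proof -
  have "outer A < outer A + ennreal e"
    using assms by (cases "outer A") (auto simp: ennreal_less_iff simp flip: ennreal_plus)
  then obtain u where "u \<in> covers A" "(SUP n. ennreal (L (u n))) < outer A + ennreal e"
    unfolding outer_def INF_less_iff by blast
  moreover have "ennreal (L (u n)) \<le> (SUP n. ennreal (L (u n)))" for n
    by (rule SUP_upper) simp
  ultimately show ?thesis using that[of u] by (meson less_imp_le order_trans)
qed

lemma outer_countable_Union: "outer (\<Union>i. A i) \<le> (\<Sum>i. outer (A i))"
proof (cases "(\<Sum>i. outer (A i)) < \<infinity>")
  case True
  have fin: "outer (A i) < \<infinity>" for i
  proof -
    have "outer (A i) \<le> (\<Sum>i. outer (A i))"
      using sum_le_suminf[of "\<lambda>i. outer (A i)" "{i}"] by (simp add: summableI)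
    then show ?thesis using True by (rule le_less_trans)
  qed
  show ?thesis
  proof (rule ennreal_le_epsilon)
    fix e :: real assume e: "0 < e"
    define d where "d i = e * (1/2) ^ Suc i" for i
    have "\<exists>u. u \<in> covers (A i) \<and> (\<forall>n. ennreal (L (u n)) \<le> outer (A i) + ennreal (d i))" for i
      using outer_approx[OF fin, of "d i" i] e unfolding d_def by (metis zero_less_mult_iff zero_less_power half_gt_zero zero_less_one)
    then obtain u where u: "\<And>i. u i \<in> covers (A i)"
      "\<And>i n. ennreal (L (u i n)) \<le> outer (A i) + ennreal (d i)"
      by metis
    define v where "v n x = (\<Sum>i\<le>n. u i n x)" for n x
    note cov = coversD[OF u(1)]
    have "v \<in> covers (\<Union>i. A i)"
      unfolding covers_def
    proof (intro CollectI conjI allI ballI impI)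
      show "v n \<in> X" for n unfolding v_def by (intro X_sum cov)
      show "0 \<le> v n x" for n x unfolding v_def by (intro sum_nonneg cov)
      show "v n x \<le> v (Suc n) x" for n x
      proof -
        have "v n x \<le> (\<Sum>i\<le>n. u i (Suc n) x)" unfolding v_def by (intro sum_mono cov)
        also have "\<dots> \<le> v (Suc n) x" unfolding v_def using cov(2) by simp
        finally show ?thesis .
      qed
      fix x and c :: real assume "x \<in> (\<Union>i. A i)" "c < 1"
      then obtain i n where n: "c < u i n x" using cov(5) by blast
      also have "u i n x \<le> u i (max i n) x" by (intro cov) simp
      also have "\<dots> \<le> v (max i n) x"
        unfolding v_def by (rule member_le_sum) (auto intro: cov)
      finally show "\<exists>n. c < v n x" by blast
    qed
    then have "outer (\<Union>i. A i) \<le> (SUP n. ennreal (L (v n)))"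
      unfolding outer_def by (rule INF_lower)
    also have "\<dots> \<le> (\<Sum>i. outer (A i) + ennreal (d i))"
    proof (rule SUP_least)
      fix n
      have "L (v n) = (\<Sum>i\<le>n. L (u i n))" unfolding v_def by (intro L_sum cov)
      then have "ennreal (L (v n)) = (\<Sum>i\<le>n. ennreal (L (u i n)))"
        using cov(6) by (simp add: sum_ennreal)
      also have "\<dots> \<le> (\<Sum>i\<le>n. outer (A i) + ennreal (d i))" by (intro sum_mono u)
      also have "\<dots> \<le> (\<Sum>i. outer (A i) + ennreal (d i))"
        by (intro sum_le_suminf summableI) auto
      finally show "ennreal (L (v n)) \<le> (\<Sum>i. outer (A i) + ennreal (d i))" .
    qed
    also have "\<dots> = (\<Sum>i. outer (A i)) + (\<Sum>i. ennreal (d i))"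
      by (intro suminf_add[symmetric] summableI)
    also have "(\<Sum>i. ennreal (d i)) = ennreal e"
    proof (rule suminf_ennreal_eq)
      show "d sums e" using sums_mult[OF power_half_series, of e] by (simp add: d_def[abs_def])
    qed (use e in \<open>simp add: d_def\<close>)
    finally show "outer (\<Union>i. A i) \<le> (\<Sum>i. outer (A i)) + ennreal e" .
  qed
qed (simp add: less_top[symmetric] top_unique)

lemma outer_measure_space_outer: "outer_measure_space UNIV outer"
  unfolding outer_measure_space_def positive_def increasing_def countably_subadditive_def
  using outer_empty outer_mono outer_countable_Union by auto

text \<open>
  The sets \<open>{f > 1}\<close> are measurable in the sense of Caratheodory: by Stone's axiom the indicator of
  such a set is the increasing limit of the functions \<open>e k = min (k (f - min f 1)) 1\<close> in \<open>X\<close>. For a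
  cover \<open>u\<close> of \<open>A\<close>, the functions \<open>min (u n) (e n)\<close> cover the part of \<open>A\<close> inside, and for each \<open>k\<close>
  the functions \<open>u n - min (u n) (e k)\<close> cover the part outside.
\<close>

lemma outer_split_superlevel:
  assumes f: "f \<in> X"
  shows "outer (A \<inter> {x. f x > 1}) + outer (A - {x. f x > 1}) \<le> outer A"
  unfolding outer_def[of A]
proof (rule INF_greatest)
  fix u assume u: "u \<in> covers A"
  note cov = coversD[OF u]
  define E where "E = {x. f x > 1}"
  define e where "e k x = min (real k * (f x - min (f x) 1)) 1" for k x
  have eX: "e k \<in> X" for k
    unfolding e_def by (intro X_min_one X_scale X_diff f)
  have e0: "0 \<le> e k x" for k x by (auto simp: e_def)
  have e_mono: "e k x \<le> e k' x" if "k \<le> k'" for k k' x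
    unfolding e_def using that by (intro min.mono mult_right_mono) auto
  define w where "w n k x = min (u n x) (e k x)" for n k x
  have wX: "w n k \<in> X" for n k unfolding w_def by (intro X_min eX cov)
  define s where "s = (SUP n. ennreal (L (w n n)))"
  have "w n n x \<le> w (Suc n) (Suc n) x" for n x
    unfolding w_def using cov(3) e_mono[of n "Suc n"] by (intro min.mono) auto
  moreover have "\<exists>n. c < w n n x" if x: "x \<in> A \<inter> E" "c < 1" for x c
  proof -
    obtain n where n: "c < u n x" using cov(5)[of x c] x by auto
    have "f x > 1" using x by (auto simp: E_def)
    then obtain k where k: "1 < real k * (f x - 1)"
      using ex_less_of_nat_mult[of "f x - 1" 1] by auto
    then have "e k x = 1" using \<open>f x > 1\<close> by (auto simp: e_def min_def)
    then have "1 \<le> e (max n k) x" using e_mono[of k "max n k" x] by simp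
    moreover have "c < u (max n k) x" using n cov(4)[of n "max n k" x] by simp
    ultimately show ?thesis using x by (intro exI[of _ "max n k"]) (simp add: w_def)
  qed
  ultimately have "(\<lambda>n. w n n) \<in> covers (A \<inter> E)"
    unfolding covers_def using wX e0 cov(2) by (auto simp: w_def)
  then have 1: "outer (A \<inter> E) \<le> s"
    unfolding outer_def s_def by (rule INF_lower)
  have 2: "ennreal (L (w k k)) + outer (A - E) \<le> (SUP n. ennreal (L (u n)))" for k
  proof (cases "SUP n. ennreal (L (u n))")
    case (real B)
    have B: "L (u n) \<le> B" for n
    proof -
      have "ennreal (L (u n)) \<le> ennreal B" unfolding real(2)[symmetric] by (rule SUP_upper) simp
      then show ?thesis using real(1) by (simp add: ennreal_le_iff)
    qed
    define v where "v n x = u n x - w n k x" for n x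
    have "v \<in> covers (A - E)"
      unfolding covers_def
    proof (intro CollectI conjI allI ballI impI)
      show "v n \<in> X" for n unfolding v_def by (intro X_diff cov wX)
      show "0 \<le> v n x" for n x by (simp add: v_def w_def)
      show "v n x \<le> v (Suc n) x" for n x using cov(3)[of n x] by (auto simp: v_def w_def min_def)
      fix x and c :: real assume x: "x \<in> A - E" "c < 1"
      then have "e k x = 0" by (auto simp: e_def E_def min_def)
      then have "v n x = u n x" for n using cov(2)[of n x] by (simp add: v_def w_def)
      then show "\<exists>n. c < v n x" using cov(5)[of x c] x by simp
    qed
    \<comment> \<open>The shift by \<open>k\<close> lets the bound below compare with the fixed number \<open>L (w k k)\<close>.\<close>
    define v' where "v' n = v (n + k)" for n
    have v': "v' \<in> covers (A - E)"
    proof -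
      note c = coversD[OF \<open>v \<in> covers (A - E)\<close>]
      have "\<exists>n. d < v' n x" if x: "x \<in> A - E" "d < 1" for x d
      proof -
        obtain n where "d < v n x" using c(5)[OF x] by blast
        then have "d < v' n x" using c(4)[of n "n + k" x] by (simp add: v'_def)
        then show ?thesis by blast
      qed
      then show ?thesis unfolding covers_def using c(1-3) by (auto simp: v'_def)
    qed
    have "L (v' n) \<le> B - L (w k k)" for n
    proof -
      have "L (v' n) = L (u (n + k)) - L (w (n + k) k)"
        unfolding v'_def v_def by (intro L_diff cov wX)
      moreover have "L (w k k) \<le> L (w (n + k) k)"
      proof (rule L_mono[OF wX wX])
        show "w k k x \<le> w (n + k) k x" for x
          unfolding w_def by (intro min.mono cov(4) order_refl) simp
      qed
      ultimately show ?thesis using B[of "n + k"] by simp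
    qed
    then have "outer (A - E) \<le> ennreal (B - L (w k k))" by (rule outer_lower[OF v'])
    moreover have "0 \<le> L (w k k)"
      using wX e0 cov(2) by (intro L_nonneg) (auto simp: w_def)
    moreover have "L (w k k) \<le> B"
      using L_mono[of "w k k" "u k"] wX cov(1) B[of k] by (force simp: w_def)
    ultimately have "ennreal (L (w k k)) + outer (A - E) \<le> ennreal (L (w k k)) + ennreal (B - L (w k k))"
      by (intro add_left_mono)
    also have "\<dots> = ennreal B"
      using \<open>0 \<le> L (w k k)\<close> \<open>L (w k k) \<le> B\<close> by (simp flip: ennreal_plus)
    finally show ?thesis unfolding real .
  next
    case top
    show ?thesis unfolding top by (rule top_greatest)
  qed
  have "outer (A \<inter> E) + outer (A - E) \<le> s + outer (A - E)" by (intro add_right_mono 1)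
  also have "\<dots> = (SUP k. ennreal (L (w k k)) + outer (A - E))"
    unfolding s_def by (rule ennreal_SUP_add_left[symmetric]) simp
  also have "\<dots> \<le> (SUP n. ennreal (L (u n)))" by (intro SUP_least 2)
  finally show "outer (A \<inter> {x. f x > 1}) + outer (A - {x. f x > 1}) \<le> (SUP n. ennreal (L (u n)))"
    unfolding E_def .
qed

interpretation Pow: sigma_algebra UNIV "UNIV :: 'a set set"
  using sigma_algebra_Pow[of "UNIV :: 'a set"] by simp

text \<open>
  The \<open>\<sigma>\<close>-algebra of the sets that split every set additively for the outer measure.
\<close>

definition caratheodory_sets :: "'a set set" where
  "caratheodory_sets = lambda_system UNIV UNIV outer"

lemma caratheodory_measure_space: "measure_space UNIV caratheodory_sets outer"
  unfolding caratheodory_sets_def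
  by (rule Pow.caratheodory_lemma[OF outer_measure_space_outer])

lemma caratheodory_sigma_algebra: "sigma_algebra UNIV caratheodory_sets"
  using caratheodory_measure_space by (simp add: measure_space_def)

lemma superlevel_one_caratheodory:
  assumes "f \<in> X"
  shows "{x. f x > 1} \<in> caratheodory_sets"
proof -
  have sa: "subadditive UNIV outer"
    using Pow.countably_subadditive_subadditive outer_measure_space_outer
    by (simp add: outer_measure_space_def)
  have "outer (A \<inter> {x. f x > 1}) + outer (A - {x. f x > 1}) = outer A" for A
  proof (rule antisym[OF outer_split_superlevel[OF assms]])
    have "outer ((A \<inter> {x. f x > 1}) \<union> (A - {x. f x > 1})) \<le>
        outer (A \<inter> {x. f x > 1}) + outer (A - {x. f x > 1})"
      by (rule subadditiveD[OF sa]) auto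
    then show "outer A \<le> outer (A \<inter> {x. f x > 1}) + outer (A - {x. f x > 1})"
      by (simp add: Int_Diff_Un)
  qed
  then show ?thesis unfolding caratheodory_sets_def Pow.lambda_system_eq by simp
qed

text \<open>
  The outer measure on all Caratheodory measurable sets.
\<close>

definition caratheodory :: "'a measure" where
  "caratheodory = measure_of UNIV caratheodory_sets outer"

lemma sets_caratheodory [simp]: "sets caratheodory = caratheodory_sets"
  and space_caratheodory [simp]: "space caratheodory = UNIV"
  using caratheodory_sigma_algebra
  by (auto simp: caratheodory_def sigma_algebra.sets_measure_of_eq sigma_algebra.sigma_sets_eq)

lemma superlevel_pos_caratheodory:
  assumes "f \<in> X" "a > 0"
  shows "{x. f x > a} \<in> caratheodory_sets"
  using superlevel_one_caratheodory[OF X_scale[OF assms(1), of "1/a"]] assms(2)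
  by (simp add: field_simps)

lemma X_borel_caratheodory:
  assumes f: "f \<in> X"
  shows "f \<in> borel_measurable caratheodory"
proof -
  have pos: "(\<lambda>x. max (g x) 0) \<in> borel_measurable caratheodory" if g: "g \<in> X" for g
  proof (subst borel_measurable_iff_greater, intro allI)
    fix a :: real
    have p: "{x. max (g x) 0 > b} \<in> sets caratheodory" if "b > 0" for b
      using superlevel_pos_caratheodory[OF g that] that by (simp add: less_max_iff_disj)
    show "{w \<in> space caratheodory. a < max (g w) 0} \<in> sets caratheodory"
    proof (cases a "0 :: real" rule: linorder_cases)
      case less
      then have "{w \<in> space caratheodory. a < max (g w) 0} = space caratheodory" by auto
      then show ?thesis by (metis sets.top)
    next
      case equal
      have "{w. 0 < max (g w) 0} = (\<Union>n. {w. max (g w) 0 > 1 / real (Suc n)})"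
      proof (intro set_eqI iffI)
        fix w assume "w \<in> {w. 0 < max (g w) 0}"
        then show "w \<in> (\<Union>n. {w. max (g w) 0 > 1 / real (Suc n)})"
          using nat_approx_posE[of "max (g w) 0"] by (metis UN_iff UNIV_I mem_Collect_eq)
      next
        fix w assume "w \<in> (\<Union>n. {w. max (g w) 0 > 1 / real (Suc n)})"
        then obtain n where "max (g w) 0 > 1 / real (Suc n)" by auto
        moreover have "0 < 1 / real (Suc n)" by simp
        ultimately show "w \<in> {w. 0 < max (g w) 0}" by (metis less_trans mem_Collect_eq)
      qed
      moreover have "(\<Union>n. {w. max (g w) 0 > 1 / real (Suc n)}) \<in> sets caratheodory"
        by (intro sets.countable_UN image_subsetI p) simp
      ultimately show ?thesis using equal by simp
    next
      case greater
      then show ?thesis using p by simp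
    qed
  qed
  have "(\<lambda>x. max (f x) 0 - max (-1 * f x) 0) \<in> borel_measurable caratheodory"
    by (intro borel_measurable_diff pos f X_scale)
  also have "(\<lambda>x. max (f x) 0 - max (-1 * f x) 0) = f" by (auto simp: max_def)
  finally show ?thesis .
qed

lemma sets_sigma_gen_subset: "sets (sigma_gen X) \<subseteq> caratheodory_sets"
proof -
  have "{f -` B | f B. f \<in> X \<and> B \<in> sets borel} \<subseteq> caratheodory_sets"
    using measurable_sets[OF X_borel_caratheodory] by auto
  then show ?thesis
    unfolding sigma_gen_def
    by (simp add: sigma_algebra.sigma_sets_subset[OF caratheodory_sigma_algebra])
qed

text \<open>
  The restriction of the outer measure to the \<open>\<sigma>\<close>-algebra generated by \<open>X\<close>.
\<close>

definition representing_measure :: "'a measure" where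
  "representing_measure = measure_of UNIV (sets (sigma_gen X)) outer"

lemma space_sigma_gen: "space (sigma_gen X) = UNIV"
  by (simp add: sigma_gen_def)

lemma sets_representing_measure [simp]: "sets representing_measure = sets (sigma_gen X)"
  and space_representing_measure [simp]: "space representing_measure = UNIV"
  using sets.sigma_algebra_axioms[of "sigma_gen X"]
  by (auto simp: representing_measure_def space_sigma_gen sigma_algebra.sets_measure_of_eq
      sigma_algebra.sigma_sets_eq)

lemma emeasure_representing_measure:
  assumes "A \<in> sets (sigma_gen X)"
  shows "emeasure representing_measure A = outer A"
  unfolding representing_measure_def
proof (rule emeasure_measure_of_sigma)
  show "sigma_algebra UNIV (sets (sigma_gen X))"
    using sets.sigma_algebra_axioms[of "sigma_gen X"] by (simp add: space_sigma_gen)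
  show "positive (sets (sigma_gen X)) outer"
    by (simp add: positive_def outer_empty)
  have "countably_additive caratheodory_sets outer"
    using caratheodory_measure_space by (simp add: measure_space_def)
  then show "countably_additive (sets (sigma_gen X)) outer"
    using sets_sigma_gen_subset unfolding countably_additive_def by (meson order_trans subsetD)
qed (fact assms)

lemma X_borel_representing:
  assumes "f \<in> X"
  shows "f \<in> borel_measurable representing_measure"
proof (rule measurableI)
  fix B :: "real set" assume "B \<in> sets borel"
  then show "f -` B \<inter> space representing_measure \<in> sets representing_measure"
    using assms by (auto simp: sigma_gen_def)
qed simp

lemma X_min_nonneg_const:
  assumes "f \<in> X" "\<And>x. 0 \<le> f x" "c \<ge> 0"
  shows "(\<lambda>x. min (f x) c) \<in> X"
proof (cases "c = 0")
  case True
  then have "(\<lambda>x. min (f x) c) = (\<lambda>x. 0)" using assms(2) by (auto simp: min_def antisym)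
  then show ?thesis using X_zero by simp
qed (use assms X_min_const in auto)

lemma L_slice_le:
  assumes f: "f \<in> X" and ab: "0 < a" "a < b"
  shows "ennreal (L (\<lambda>x. min (f x) b - min (f x) a)) \<le> ennreal (b - a) * outer {x. f x > a}"
proof -
  let ?g = "\<lambda>x. min (f x) b - min (f x) a"
  have g: "?g \<in> X" using f ab by (intro X_diff X_min_const) auto
  have "ennreal (L (\<lambda>x. (1 / (b - a)) * ?g x)) \<le> outer {x. f x > a}"
    using ab by (intro L_le_outer X_scale g) (auto simp: min_def field_simps)
  then have "ennreal (b - a) * ennreal (1 / (b - a) * L ?g) \<le> ennreal (b - a) * outer {x. f x > a}"
    unfolding L_scale[OF g] by (rule mult_left_mono) simp
  then show ?thesis using ab by (simp flip: ennreal_mult')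
qed

lemma le_L_slice:
  assumes f: "f \<in> X" "\<And>x. 0 \<le> f x" and ab: "0 \<le> a" "a < b"
  shows "ennreal (b - a) * outer {x. f x > b} \<le> ennreal (L (\<lambda>x. min (f x) b - min (f x) a))"
proof -
  let ?g = "\<lambda>x. min (f x) b - min (f x) a"
  have g: "?g \<in> X" using f ab by (intro X_diff X_min_nonneg_const) auto
  have "outer {x. f x > b} \<le> ennreal (L (\<lambda>x. (1 / (b - a)) * ?g x))"
    using ab by (intro outer_le_L X_scale g) (auto simp: min_def field_simps)
  then have "ennreal (b - a) * outer {x. f x > b} \<le> ennreal (b - a) * ennreal (1 / (b - a) * L ?g)"
    unfolding L_scale[OF g] by (rule mult_left_mono) simp
  then show ?thesis using ab by (simp flip: ennreal_mult')
qed

lemma nn_integral_layers: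
  assumes f: "f \<in> X" and h: "0 < h"
  shows "(\<integral>\<^sup>+x. ennreal (\<Sum>j<M. h * of_bool (f x > real (Suc j) * h)) \<partial>representing_measure) =
    (\<Sum>j<M. ennreal h * outer {x. f x > real (Suc j) * h})"
proof -
  note [measurable] = X_borel_representing[OF f]
  have ind: "ennreal (h * of_bool (f x > c)) = ennreal h * indicator {x. f x > c} x" for x c
    by (auto simp: indicator_def)
  have meas: "{x. f x > c} \<in> sets representing_measure" for c
  proof -
    have "{x \<in> space representing_measure. f x > c} \<in> sets representing_measure" by measurable
    then show ?thesis by simp
  qed
  have "(\<integral>\<^sup>+x. ennreal (\<Sum>j<M. h * of_bool (f x > real (Suc j) * h)) \<partial>representing_measure) =
      (\<integral>\<^sup>+x. (\<Sum>j<M. ennreal h * indicator {x. f x > real (Suc j) * h} x) \<partial>representing_measure)"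
    unfolding ind[symmetric] using h by (intro nn_integral_cong sum_ennreal[symmetric]) simp
  also have "\<dots> = (\<Sum>j<M. \<integral>\<^sup>+x. ennreal h * indicator {x. f x > real (Suc j) * h} x \<partial>representing_measure)"
    using meas by (intro nn_integral_sum borel_measurable_times borel_measurable_indicator) auto
  also have "\<dots> = (\<Sum>j<M. ennreal h * outer {x. f x > real (Suc j) * h})"
    using meas by (simp add: nn_integral_cmult_indicator emeasure_representing_measure)
  finally show ?thesis .
qed

text \<open>
  The functional \<open>L\<close> satisfies the same layer estimates as the integral, which determines it.
\<close>

lemma layers_bounds:
  assumes f: "f \<in> X" "\<And>x. 0 \<le> f x" and h: "0 < h"
  shows "ennreal (L (\<lambda>x. min (f x) (real (Suc M) * h) - min (f x) h)) \<le>
      (\<Sum>j<M. ennreal h * outer {x. f x > real (Suc j) * h})"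
    and "(\<Sum>j<M. ennreal h * outer {x. f x > real (Suc j) * h}) \<le> ennreal (L f)"
proof -
  define S where "S j x = min (f x) (real (Suc j) * h) - min (f x) (real j * h)" for j x
  have S: "S j \<in> X" for j
    unfolding S_def using f h by (intro X_diff X_min_nonneg_const) auto
  have S0: "0 \<le> S j x" for j x
    unfolding S_def using h by (auto simp: min_def algebra_simps)
  have diff: "real (Suc j) * h - real j * h = h" for j by (simp add: algebra_simps)
  have "(\<lambda>x. min (f x) (real (Suc M) * h) - min (f x) h) = (\<lambda>x. \<Sum>j<M. S (Suc j) x)"
    unfolding S_def by (subst sum_lessThan_telescope) simp
  then have "ennreal (L (\<lambda>x. min (f x) (real (Suc M) * h) - min (f x) h)) = (\<Sum>j<M. ennreal (L (S (Suc j))))"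
    using L_sum[of "{..<M}" "\<lambda>j. S (Suc j)"] S L_nonneg[OF S S0] by (simp add: sum_ennreal)
  also have "\<dots> \<le> (\<Sum>j<M. ennreal h * outer {x. f x > real (Suc j) * h})"
  proof (rule sum_mono)
    fix j
    show "ennreal (L (S (Suc j))) \<le> ennreal h * outer {x. f x > real (Suc j) * h}"
      using L_slice_le[OF f(1), of "real (Suc j) * h" "real (Suc (Suc j)) * h"] h
      unfolding S_def diff by simp
  qed
  finally show "ennreal (L (\<lambda>x. min (f x) (real (Suc M) * h) - min (f x) h)) \<le>
      (\<Sum>j<M. ennreal h * outer {x. f x > real (Suc j) * h})" .
  have "(\<Sum>j<M. ennreal h * outer {x. f x > real (Suc j) * h}) \<le> (\<Sum>j<M. ennreal (L (S j)))"
  proof (rule sum_mono)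
    fix j
    show "ennreal h * outer {x. f x > real (Suc j) * h} \<le> ennreal (L (S j))"
      using le_L_slice[OF f, of "real j * h" "real (Suc j) * h"] h
      unfolding S_def diff by simp
  qed
  also have "\<dots> = ennreal (L (\<lambda>x. \<Sum>j<M. S j x))"
    using L_sum[of "{..<M}" S] S L_nonneg[OF S S0] by (simp add: sum_ennreal)
  also have "\<dots> \<le> ennreal (L f)"
  proof (intro ennreal_leI L_mono X_sum S f)
    show "(\<Sum>j<M. S j x) \<le> f x" for x
      unfolding S_def using f(2)[of x] by (subst sum_lessThan_telescope) (auto simp: min_def)
  qed
  finally show "(\<Sum>j<M. ennreal h * outer {x. f x > real (Suc j) * h}) \<le> ennreal (L f)" .
qed

text \<open>
  Both \<open>L\<close> and the integral are continuous along the truncations \<open>F n\<close> of \<open>f\<close> to heights between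
  \<open>1 / (n+1)\<close> and \<open>n + 1\<close>. The lower cut keeps the superlevel sets in use away from height \<open>0\<close>, where
  their measure may be infinite; the layers have height \<open>1 / (n+1)\<close>.
\<close>

lemma nn_integral_representing:
  assumes f: "f \<in> X" "\<And>x. 0 \<le> f x"
  shows "(\<integral>\<^sup>+x. ennreal (f x) \<partial>representing_measure) = ennreal (L f)"
proof -
  note [measurable] = X_borel_representing[OF f(1)]
  define F where "F n x = min (f x) (real (Suc n)) - min (f x) (1 / real (Suc n))" for n x
  have FX: "F n \<in> X" for n unfolding F_def by (intro X_diff X_min_const f) auto
  have F_mono: "F n x \<le> F (Suc n) x" for n x
  proof -
    have "min (f x) (1 / real (Suc (Suc n))) \<le> min (f x) (1 / real (Suc n))"
      by (intro min.mono divide_left_mono) auto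
    moreover have "min (f x) (real (Suc n)) \<le> min (f x) (real (Suc (Suc n)))"
      by (intro min.mono) auto
    ultimately show ?thesis unfolding F_def by linarith
  qed
  have F_lim: "(\<lambda>n. F n x) \<longlonglongrightarrow> f x" for x
  proof -
    have "(\<lambda>n. min (f x) (1 / real (Suc n))) \<longlonglongrightarrow> min (f x) 0"
      by (intro tendsto_min tendsto_const LIMSEQ_Suc[OF lim_1_over_n])
    moreover have "(\<lambda>n. min (f x) (real (Suc n))) \<longlonglongrightarrow> f x"
    proof (rule tendsto_eventually)
      obtain N where "f x \<le> real N" using real_arch_simple by blast
      then show "\<forall>\<^sub>F n in sequentially. min (f x) (real (Suc n)) = f x"
        by (intro eventually_sequentiallyI[of N]) (auto simp: min_def)
    qed
    ultimately have "(\<lambda>n. F n x) \<longlonglongrightarrow> f x - min (f x) 0"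
      unfolding F_def by (intro tendsto_diff)
    then show ?thesis using f(2)[of x] by (simp add: min_def split: if_splits)
  qed
  have F_layers: "F n x \<le> (\<Sum>j<n*n+2*n. (1 / real (Suc n)) * of_bool (f x > real (Suc j) * (1 / real (Suc n))))"
    (is "_ \<le> ?s n x")
    and layers_le: "(\<Sum>j<n*n+2*n. (1 / real (Suc n)) * of_bool (f x > real (Suc j) * (1 / real (Suc n)))) \<le> f x"
    and L_F: "ennreal (L (F n)) \<le> (\<Sum>j<n*n+2*n. ennreal (1 / real (Suc n)) * outer {x. f x > real (Suc j) * (1 / real (Suc n))})"
    for n x
  proof -
    \<comment> \<open>The number of layers is chosen so that the topmost one ends at height \<open>n + 1\<close>.\<close>
    have "real (Suc (n*n+2*n)) * (1 / real (Suc n)) = real (Suc n)"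
      by (simp add: field_simps)
    then have eq: "F n = (\<lambda>x. min (f x) (real (Suc (n*n+2*n)) * (1 / real (Suc n))) - min (f x) (1 / real (Suc n)))"
      unfolding F_def by simp
    show "F n x \<le> (\<Sum>j<n*n+2*n. (1 / real (Suc n)) * of_bool (f x > real (Suc j) * (1 / real (Suc n))))"
      unfolding eq by (intro slice_layers f) simp
    show "(\<Sum>j<n*n+2*n. (1 / real (Suc n)) * of_bool (f x > real (Suc j) * (1 / real (Suc n)))) \<le> f x"
      by (intro slice_layers f) simp
    show "ennreal (L (F n)) \<le> (\<Sum>j<n*n+2*n. ennreal (1 / real (Suc n)) * outer {x. f x > real (Suc j) * (1 / real (Suc n))})"
      unfolding eq by (intro layers_bounds f) simp
  qed
  let ?I = "\<lambda>g. \<integral>\<^sup>+x. ennreal (g x) \<partial>representing_measure"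
  have layers: "?I (?s n) = (\<Sum>j<n*n+2*n. ennreal (1 / real (Suc n)) * outer {x. f x > real (Suc j) * (1 / real (Suc n))})" for n
    by (intro nn_integral_layers f) simp
  have "(\<lambda>n. ?I (F n)) \<longlonglongrightarrow> ?I f"
  proof (rule nn_integral_LIMSEQ)
    show "incseq (\<lambda>n x. ennreal (F n x))"
      using F_mono by (intro incseq_SucI) (auto simp: le_fun_def intro: ennreal_leI)
    show "(\<lambda>x. ennreal (F n x)) \<in> borel_measurable representing_measure" for n
      by (intro measurable_compose[OF X_borel_representing[OF FX] measurable_ennreal])
    show "(\<lambda>n. ennreal (F n x)) \<longlonglongrightarrow> ennreal (f x)" for x
      using F_lim by (intro tendsto_ennrealI)
  qed
  moreover have "?I (F n) \<le> ennreal (L f)" for n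
  proof -
    have "?I (F n) \<le> ?I (?s n)" by (intro nn_integral_mono ennreal_leI F_layers)
    also have "\<dots> \<le> ennreal (L f)" unfolding layers by (intro layers_bounds f) simp
    finally show ?thesis .
  qed
  ultimately have le: "?I f \<le> ennreal (L f)" by (intro LIMSEQ_le_const2) auto
  have "(\<lambda>n. L (\<lambda>x. f x - F n x)) \<longlonglongrightarrow> 0"
  proof (rule L_cont)
    show "(\<lambda>x. f x - F n x) \<in> X" for n by (intro X_diff f FX)
    show "f x - F (Suc n) x \<le> f x - F n x" for n x using F_mono[of n x] by simp
    show "(\<lambda>n. f x - F n x) \<longlonglongrightarrow> 0" for x
      using tendsto_diff[OF tendsto_const F_lim, of "f x" x] by simp
  qed
  then have "(\<lambda>n. L f - L (\<lambda>x. f x - F n x)) \<longlonglongrightarrow> L f - 0" by (intro tendsto_intros)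
  then have "(\<lambda>n. L (F n)) \<longlonglongrightarrow> L f" using L_diff[OF f(1) FX] by simp
  then have "(\<lambda>n. ennreal (L (F n))) \<longlonglongrightarrow> ennreal (L f)" by (rule tendsto_ennrealI)
  moreover have "ennreal (L (F n)) \<le> ?I f" for n
  proof -
    have "ennreal (L (F n)) \<le> ?I (?s n)" unfolding layers by (rule L_F)
    also have "\<dots> \<le> ?I f" by (intro nn_integral_mono ennreal_leI layers_le)
    finally show ?thesis .
  qed
  ultimately have "ennreal (L f) \<le> ?I f" by (intro LIMSEQ_le_const2) auto
  with le show ?thesis by (rule antisym)
qed

theorem representing_measure_ca_plus: "representing_measure \<in> ca_plus X"
  unfolding ca_plus_def nonneg_part_def
  by (auto simp: nn_integral_representing le_fun_def)

theorem integral_representing: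
  assumes f: "f \<in> X"
  shows "integral\<^sup>L representing_measure f = L f"
proof -
  have pos: "integrable representing_measure g" "integral\<^sup>L representing_measure g = L g"
    if "g \<in> X" "\<And>x. 0 \<le> g x" for g
  proof -
    have "has_bochner_integral representing_measure g (L g)"
      using that by (intro has_bochner_integral_nn_integral)
        (auto simp: nn_integral_representing X_borel_representing L_nonneg)
    then show "integrable representing_measure g" "integral\<^sup>L representing_measure g = L g"
      by (auto simp: has_bochner_integral_iff)
  qed
  define p n where "p x = max (f x) 0" and "n x = max (-1 * f x) 0" for x
  have X: "p \<in> X" "n \<in> X"
    unfolding p_def n_def by (intro X_max X_scale X_zero f)+
  have pn: "0 \<le> p x" "0 \<le> n x" for x by (simp_all add: p_def n_def)
  have "f = (\<lambda>x. p x - n x)" by (auto simp: p_def n_def max_def)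
  moreover have "integral\<^sup>L representing_measure (\<lambda>x. p x - n x) = L p - L n"
    using pos[OF X(1) pn(1)] pos[OF X(2) pn(2)] by simp
  ultimately show ?thesis using L_diff[OF X] by simp
qed

end

section \<open>Continuity of subgradients along decreasing sequences\<close>

lemma nonneg_decreasingD:
  assumes "decreases_to_zero_in (nonneg_part X) F"
  shows "n \<ge> 1 \<Longrightarrow> F n \<in> X" "n \<ge> 1 \<Longrightarrow> 0 \<le> F n x" "(\<lambda>n. F n x) \<longlonglongrightarrow> 0"
    "1 \<le> m \<Longrightarrow> m \<le> n \<Longrightarrow> F n x \<le> F m x"
proof -
  show "n \<ge> 1 \<Longrightarrow> F n \<in> X" "n \<ge> 1 \<Longrightarrow> 0 \<le> F n x" "(\<lambda>n. F n x) \<longlonglongrightarrow> 0"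
    using assms by (auto simp: decreases_to_zero_in_def nonneg_part_def le_fun_def)
  assume m: "1 \<le> m"
  assume "m \<le> n"
  then show "F n x \<le> F m x"
  proof (induction n rule: dec_induct)
    case (step n)
    have "F (Suc n) x \<le> F n x"
      using assms m step.hyps by (auto simp: decreases_to_zero_in_def le_fun_def)
    with step.IH show ?case by simp
  qed simp
qed

text \<open>
  Dini's theorem, for an arbitrary compact set and sequences indexed from \<open>1\<close>.
\<close>

lemma dini_compact:
  fixes F :: "nat \<Rightarrow> 'a::topological_space \<Rightarrow> real"
  assumes K: "compact K"
    and cont: "\<And>n. n \<ge> 1 \<Longrightarrow> continuous_on UNIV (F n)"
    and decr: "\<And>m n x. 1 \<le> m \<Longrightarrow> m \<le> n \<Longrightarrow> F n x \<le> F m x"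
    and lim: "\<And>x. (\<lambda>n. F n x) \<longlonglongrightarrow> 0"
    and "\<eta> > 0"
  shows "\<exists>N. \<forall>n\<ge>N. \<forall>x\<in>K. F n x < \<eta>"
proof -
  have "open {x. F n x < \<eta>}" if "n \<in> {1..}" for n
    using that cont by (intro open_Collect_less continuous_intros) auto
  moreover have "K \<subseteq> (\<Union>n\<in>{1..}. {x. F n x < \<eta>})"
  proof
    fix x
    have "\<forall>\<^sub>F n in sequentially. F n x < \<eta> \<and> 1 \<le> n"
      using order_tendstoD(2)[OF lim \<open>\<eta> > 0\<close>] eventually_ge_at_top by (rule eventually_conj)
    then obtain n where "F n x < \<eta>" "1 \<le> n" by (auto simp: eventually_sequentially)
    then show "x \<in> (\<Union>n\<in>{1..}. {x. F n x < \<eta>})" by auto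
  qed
  ultimately obtain C where C: "C \<subseteq> {1..}" "finite C" "K \<subseteq> (\<Union>n\<in>C. {x. F n x < \<eta>})"
    by (rule compactE_image[OF K])
  show ?thesis
  proof (intro exI[of _ "Max (insert 1 C)"] allI impI ballI)
    fix n x assume n: "Max (insert 1 C) \<le> n" and "x \<in> K"
    then obtain c where c: "c \<in> C" "F c x < \<eta>" using C(3) by blast
    then have "c \<le> n" using n C(2) by (meson Max_ge finite_insert insertI2 order_trans)
    then show "F n x < \<eta>" using decr[of c n x] c C(1) by force
  qed
qed

text \<open>
  Weights with sum below \<open>1\<close> are completed by the weight of \<open>0\<close>.
\<close>

lemma convex_on_subconvex:
  assumes \<psi>: "convex_on Y \<psi>" and Y: "0 \<in> Y" "a \<in> Y" "b \<in> Y" and uv: "u \<ge> 0" "v \<ge> 0" "u + v \<le> 1"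
  shows "u *\<^sub>R a + v *\<^sub>R b \<in> Y"
    and "\<psi> (u *\<^sub>R a + v *\<^sub>R b) \<le> u * \<psi> a + v * \<psi> b + (1 - u - v) * \<psi> 0"
proof -
  have two: "p *\<^sub>R x + q *\<^sub>R y \<in> Y" "\<psi> (p *\<^sub>R x + q *\<^sub>R y) \<le> p * \<psi> x + q * \<psi> y"
    if "x \<in> Y" "y \<in> Y" "0 \<le> p" "0 \<le> q" "p + q = 1" for x y p q
    using \<psi> that unfolding convex_on_def convex_def by blast+
  have "u *\<^sub>R a + v *\<^sub>R b \<in> Y \<and>
    \<psi> (u *\<^sub>R a + v *\<^sub>R b) \<le> u * \<psi> a + v * \<psi> b + (1 - u - v) * \<psi> 0"
  proof (cases "u + v = 0")
    case True
    then have "u = 0" "v = 0" using uv by auto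
    then show ?thesis using Y by simp
  next
    case False
    define w where "w = u + v"
    have w: "0 < w" "w \<le> 1" using False uv by (auto simp: w_def)
    define c where "c = (u / w) *\<^sub>R a + (v / w) *\<^sub>R b"
    have "u / w + v / w = 1" using w by (simp add: w_def flip: add_divide_distrib)
    then have 1: "c \<in> Y" "\<psi> c \<le> (u / w) * \<psi> a + (v / w) * \<psi> b"
      unfolding c_def using uv w by (intro two Y; simp)+
    have 2: "w *\<^sub>R c + (1 - w) *\<^sub>R 0 \<in> Y" "\<psi> (w *\<^sub>R c + (1 - w) *\<^sub>R 0) \<le> w * \<psi> c + (1 - w) * \<psi> 0"
      using w by (intro two Y 1(1); simp)+
    have "w *\<^sub>R c + (1 - w) *\<^sub>R 0 = u *\<^sub>R a + v *\<^sub>R b"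
      using w by (simp add: c_def scaleR_add_right)
    moreover have "w * \<psi> c \<le> u * \<psi> a + v * \<psi> b"
      using mult_left_mono[OF 1(2), of w] w by (simp add: distrib_left)
    moreover have eq: "1 - u - v = 1 - w" by (simp add: w_def)
    ultimately show ?thesis using 2 unfolding eq by simp
  qed
  then show "u *\<^sub>R a + v *\<^sub>R b \<in> Y"
    "\<psi> (u *\<^sub>R a + v *\<^sub>R b) \<le> u * \<psi> a + v * \<psi> b + (1 - u - v) * \<psi> 0" by auto
qed

text \<open>
  A positive subgradient \<open>L\<close> of \<open>\<phi>\<close> at the algebraic interior point \<open>f\<close> of its domain, where \<open>\<phi>\<close> has
  the value \<open>r\<close>.
\<close>

locale subgradient_at_interior =
  fixes X :: "('a::topological_space \<Rightarrow> real) set" and \<phi> :: "('a \<Rightarrow> real) \<Rightarrow> ereal"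
    and f :: "'a \<Rightarrow> real" and r :: real and L :: "('a \<Rightarrow> real) \<Rightarrow> real"
  assumes stone: "stone_vector_lattice X"
    and cont: "\<And>h. h \<in> X \<Longrightarrow> continuous_on UNIV h"
    and interior: "f \<in> alg_interior_dom X \<phi>"
    and \<phi>_f: "\<phi> f = ereal r"
    and L_add: "\<And>g h. g \<in> X \<Longrightarrow> h \<in> X \<Longrightarrow> L (g + h) = L g + L h"
    and L_scale: "\<And>c h. h \<in> X \<Longrightarrow> L (c *\<^sub>R h) = c * L h"
    and L_nonneg: "\<And>h. h \<in> X \<Longrightarrow> 0 \<le> h \<Longrightarrow> 0 \<le> L h"
    and below: "\<And>h. h \<in> X \<Longrightarrow> ereal (r + L h) \<le> \<phi> (f + h)"
begin

lemma L_le_majorant: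
  assumes "h \<in> X" "ereal c \<ge> \<phi> (f + h) - \<phi> f"
  shows "L h \<le> c"
  using assms(2) below[OF assms(1)] \<phi>_f by (cases "\<phi> (f + h)") auto

lemma subspace_X: "subspace X"
  using stone by (simp add: stone_vector_lattice_def)

lemma L_mono:
  assumes "g \<in> X" "h \<in> X" "g \<le> h"
  shows "L g \<le> L h"
proof -
  have "0 \<le> L (h - g)"
    using assms subspace_diff[OF subspace_X] by (intro L_nonneg) (auto simp: le_fun_def)
  moreover have "L ((h - g) + g) = L (h - g) + L g"
    using assms subspace_diff[OF subspace_X] by (intro L_add) auto
  ultimately show ?thesis by simp
qed

text \<open>
  Put \<open>H n = (1 + 1/n) F n\<close>. Where \<open>g \<ge> \<epsilon>\<close>, \<open>\<epsilon> H n \<le> g H n\<close>. Where \<open>g < \<epsilon>\<close>, writing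
  \<open>\<epsilon> H n = g H n + (\<epsilon> - g) H n\<close> and bounding the second \<open>H n\<close> by a small \<open>\<eta>\<close> gives
  \<open>\<epsilon> H n \<le> g H n + \<eta> (\<epsilon> - g)\<close>. As \<open>H n \<le> (1 - s) H m\<close>, in both cases \<open>\<epsilon> H n\<close> is at most
  \<open>(1 - s) (H m g) + \<eta> max 0 (\<epsilon> - g)\<close>, whose weights sum to at most \<open>1\<close> if \<open>\<eta> \<le> s\<close>.
\<close>

lemma eventually_small_A:
  assumes A: "condition_A X \<phi>" and F: "decreases_to_zero_in (nonneg_part X) F" and "e > 0"
  shows "\<exists>N. \<forall>n\<ge>N. L (F n) \<le> e"
proof -
  note FX = nonneg_decreasingD(1)[OF F] and F0 = nonneg_decreasingD(2)[OF F]
    and F_lim = nonneg_decreasingD(3)[OF F] and F_decr = nonneg_decreasingD(4)[OF F]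
  \<comment> \<open>The factors \<open>1 + 1/n\<close> put all later terms below a fixed multiple, less than \<open>1\<close>, of the \<open>m\<close>-th
    one, which leaves room for a further summand in convex combinations.\<close>
  define H where "H n = (1 + 1 / real n) *\<^sub>R F n" for n
  have H: "decreases_to_zero_in (nonneg_part X) H"
    unfolding decreases_to_zero_in_def
  proof (intro conjI allI impI)
    fix n :: nat assume n: "n \<ge> 1"
    show "H n \<in> nonneg_part X"
      using FX[OF n] F0[OF n] subspace_scale[OF subspace_X]
      by (auto simp: H_def nonneg_part_def le_fun_def)
    show "H (Suc n) \<le> H n"
    proof (rule le_funI)
      fix x
      have "(1 + 1 / real (Suc n)) * F (Suc n) x \<le> (1 + 1 / real n) * F n x"
        using n F_decr[OF n, of "Suc n" x] F0[of "Suc n" x] by (intro mult_mono) (auto intro!: divide_left_mono)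
      then show "H (Suc n) x \<le> H n x" by (simp add: H_def)
    qed
  next
    fix x
    have "(\<lambda>n. (1 + 1 / real n) * F n x) \<longlonglongrightarrow> (1 + 0) * 0"
      by (intro tendsto_intros lim_1_over_n F_lim)
    then show "(\<lambda>n. H n x) \<longlonglongrightarrow> 0" by (simp add: H_def)
  qed
  note HX = nonneg_decreasingD(1)[OF H] and H0 = nonneg_decreasingD(2)[OF H]
    and H_lim = nonneg_decreasingD(3)[OF H] and H_decr = nonneg_decreasingD(4)[OF H]
  obtain \<epsilon> where \<epsilon>: "\<epsilon> > 0" and cond: "\<forall>\<delta>>0. \<exists>m\<ge>1. \<exists>g\<ge>0. \<exists>Y (\<psi> :: ('a \<Rightarrow> real) \<Rightarrow> real).
          Y \<subseteq> {h. 0 \<le> h} \<and> convex_on Y \<psi> \<and> mono_on Y \<psi> \<and>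
          {0, H m * g, (\<lambda>x. max 0 (\<epsilon> - g x))} \<union> {\<epsilon> *\<^sub>R H n | n. n \<ge> m} \<subseteq> Y \<and>
          relatively_compact {x. g x < \<epsilon>} \<and>
          \<psi> (H m * g) \<le> \<delta> \<and>
          (\<forall>n\<ge>m. ereal (\<psi> (\<epsilon> *\<^sub>R H n)) \<ge> \<phi> (f + \<epsilon> *\<^sub>R H n) - \<phi> f)"
    using A[unfolded condition_A_def, rule_format, OF interior H] by blast
  \<comment> \<open>The estimate at the end is \<open>\<psi> (\<epsilon> H n) \<le> 2 \<delta>\<close>.\<close>
  define \<delta> where "\<delta> = \<epsilon> * e / 2"
  have \<delta>: "\<delta> > 0" using \<epsilon> \<open>e > 0\<close> by (simp add: \<delta>_def)
  from cond[rule_format, OF \<delta>] obtain m g Y and \<psi> :: "('a \<Rightarrow> real) \<Rightarrow> real"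
    where m: "m \<ge> 1" and g: "0 \<le> g" and Ypos: "Y \<subseteq> {h. 0 \<le> h}" and \<psi>: "convex_on Y \<psi>" "mono_on Y \<psi>"
      and Y: "{0, H m * g, (\<lambda>x. max 0 (\<epsilon> - g x))} \<union> {\<epsilon> *\<^sub>R H n | n. n \<ge> m} \<subseteq> Y"
      and cpt: "relatively_compact {x. g x < \<epsilon>}" and \<psi>\<delta>: "\<psi> (H m * g) \<le> \<delta>"
      and major: "\<forall>n\<ge>m. ereal (\<psi> (\<epsilon> *\<^sub>R H n)) \<ge> \<phi> (f + \<epsilon> *\<^sub>R H n) - \<phi> f"
    by blast
  define k where "k = (\<lambda>x. max 0 (\<epsilon> - g x))"
  have Y0: "0 \<in> Y" and Yg: "H m * g \<in> Y" and Yk: "k \<in> Y" and YH: "\<And>n. n \<ge> m \<Longrightarrow> \<epsilon> *\<^sub>R H n \<in> Y"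
    using Y by (auto simp: k_def)
  \<comment> \<open>Chosen such that \<open>(1 - s) H m = (1 + 1 / (m+1)) F m\<close>.\<close>
  define s where "s = 1 - (1 + 1 / real (Suc m)) / (1 + 1 / real m)"
  have s: "0 < s" "s < 1" using m by (auto simp: s_def field_simps add_pos_pos)
  define \<eta> where "\<eta> = min s (\<delta> / (\<bar>\<psi> k\<bar> + 1))"
  have \<eta>: "\<eta> > 0" "\<eta> \<le> s" using s \<delta> by (auto simp: \<eta>_def)
  have \<eta>k: "\<eta> * \<psi> k \<le> \<delta>"
  proof -
    have "\<eta> * \<psi> k \<le> \<eta> * (\<bar>\<psi> k\<bar> + 1)" using \<eta> by (intro mult_left_mono) auto
    also have "\<dots> \<le> (\<delta> / (\<bar>\<psi> k\<bar> + 1)) * (\<bar>\<psi> k\<bar> + 1)" by (intro mult_right_mono) (auto simp: \<eta>_def)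
    also have "\<dots> = \<delta>" by simp
    finally show ?thesis .
  qed
  have "\<exists>N. \<forall>n\<ge>N. \<forall>x\<in>closure {x. g x < \<epsilon>}. H n x < \<eta>"
    using cpt \<eta> unfolding relatively_compact_def
    by (intro dini_compact cont HX H_decr H_lim) auto
  then obtain N where N: "\<And>n x. n \<ge> N \<Longrightarrow> x \<in> closure {x. g x < \<epsilon>} \<Longrightarrow> H n x < \<eta>"
    by blast
  have "L (F n) \<le> e" if n: "n \<ge> max N (Suc m)" for n
  proof -
    have n1: "n \<ge> 1" "n \<ge> m" "n \<ge> Suc m" "n \<ge> N" using n m by auto
    have Hs: "H n x \<le> (1 - s) * H m x" for x
    proof -
      have "(1 + 1 / real n) * F n x \<le> (1 + 1 / real (Suc m)) * F m x"
        using n1 m F_decr[of m n x] F0[OF n1(1)]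
        by (intro mult_mono) (auto intro!: divide_left_mono simp: of_nat_Suc[symmetric] simp del: of_nat_Suc)
      also have "1 + 1 / real (Suc m) = (1 - s) * (1 + 1 / real m)"
        using m by (simp add: s_def add_pos_pos less_imp_neq[symmetric])
      finally show ?thesis by (simp add: H_def mult.assoc)
    qed
    have le: "\<epsilon> *\<^sub>R H n \<le> (1 - s) *\<^sub>R (H m * g) + \<eta> *\<^sub>R k"
    proof (rule le_funI)
      fix x
      have g0: "0 \<le> g x" using g by (simp add: le_fun_def)
      have gH: "g x * H n x \<le> g x * ((1 - s) * H m x)" using g0 Hs by (rule mult_left_mono[rotated])
      show "(\<epsilon> *\<^sub>R H n) x \<le> ((1 - s) *\<^sub>R (H m * g) + \<eta> *\<^sub>R k) x"
      proof (cases "g x < \<epsilon>")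
        case True
        then have "x \<in> closure {x. g x < \<epsilon>}" by (intro closure_subset[THEN subsetD]) simp
        then have "H n x < \<eta>" by (rule N[OF n1(4)])
        then have "(\<epsilon> - g x) * H n x \<le> (\<epsilon> - g x) * \<eta>" using True by (intro mult_left_mono) auto
        then show ?thesis using gH True by (simp add: k_def algebra_simps)
      next
        case False
        then have "\<epsilon> * H n x \<le> g x * H n x" using H0[OF n1(1)] by (intro mult_right_mono) auto
        then show ?thesis using gH False by (simp add: k_def algebra_simps)
      qed
    qed
    have \<psi>0: "\<psi> 0 \<le> \<delta>"
      \<comment> \<open>\<open>0 \<le> H m g\<close> and \<open>\<psi>\<close> is increasing.\<close>
      using mono_onD[OF \<psi>(2) Y0 Yg] Yg Ypos \<psi>\<delta> by force
    note conv = convex_on_subconvex[OF \<psi>(1) Y0 Yg Yk, of "1 - s" \<eta>]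
    have "\<psi> (\<epsilon> *\<^sub>R H n) \<le> \<psi> ((1 - s) *\<^sub>R (H m * g) + \<eta> *\<^sub>R k)"
      using s \<eta> by (intro mono_onD[OF \<psi>(2) YH conv(1) le] n1) auto
    also have "\<dots> \<le> (1 - s) * \<psi> (H m * g) + \<eta> * \<psi> k + (1 - (1 - s) - \<eta>) * \<psi> 0"
      using s \<eta> by (intro conv(2)) auto
    also have "\<dots> \<le> (1 - s) * \<delta> + \<delta> + (1 - (1 - s) - \<eta>) * \<delta>"
      using s \<eta> \<psi>\<delta> \<psi>0 \<eta>k by (intro add_mono mult_left_mono) auto
    also have "\<dots> \<le> 2 * \<delta>" using \<eta> \<delta> by (simp add: algebra_simps)
    finally have "\<psi> (\<epsilon> *\<^sub>R H n) \<le> \<epsilon> * e" by (simp add: \<delta>_def)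
    moreover have "L (\<epsilon> *\<^sub>R H n) \<le> \<psi> (\<epsilon> *\<^sub>R H n)"
      using major n1 HX[OF n1(1)] subspace_scale[OF subspace_X] by (intro L_le_majorant) auto
    ultimately have "\<epsilon> * L (H n) \<le> \<epsilon> * e" using L_scale[OF HX[OF n1(1)]] by simp
    then have "L (H n) \<le> e" using \<epsilon> by simp
    moreover have "L (F n) \<le> L (H n)"
    proof (intro L_mono FX HX n1 le_funI)
      show "F n x \<le> H n x" for x using F0[OF n1(1), of x] by (simp add: H_def algebra_simps)
    qed
    ultimately show ?thesis by simp
  qed
  then show ?thesis by blast
qed

text \<open>
  For fixed \<open>n\<close> and large \<open>j\<close>, \<open>F j \<le> \<eta> \<le> \<eta> (k n) G n\<close> on \<open>{F m > g / n}\<close>, and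
  \<open>F j \<le> F m \<le> g / n\<close> elsewhere. So \<open>F j / m\<close> is at most a combination of \<open>g\<close> and \<open>G n\<close> with weights
  \<open>1 / (n m)\<close> and \<open>\<eta> (k n) / m\<close>, both of which become small; recall that \<open>\<psi> 0 = 0\<close>.
\<close>

lemma eventually_small_B:
  assumes B: "condition_B X \<phi>" and F: "decreases_to_zero_in (nonneg_part X) F" and "e > 0"
  shows "\<exists>N. \<forall>n\<ge>N. L (F n) \<le> e"
proof -
  note FX = nonneg_decreasingD(1)[OF F] and F0 = nonneg_decreasingD(2)[OF F]
    and F_lim = nonneg_decreasingD(3)[OF F] and F_decr = nonneg_decreasingD(4)[OF F]
  obtain g G m k Y and \<psi> :: "('a \<Rightarrow> real) \<Rightarrow> real"
    where g: "0 \<le> g" and G: "\<forall>n\<ge>1. 0 \<le> G n" and m: "m \<ge> 1" and k: "\<forall>n\<ge>1. k n \<ge> (1::nat)"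
      and Ypos: "Y \<subseteq> {h. 0 \<le> h}" and \<psi>: "convex_on Y \<psi>" "mono_on Y \<psi>"
      and Y: "{0, g} \<union> {(1 / real m) *\<^sub>R F n | n. n \<ge> m} \<union> {G n | n. n \<ge> m} \<subseteq> Y"
      and cpt: "\<forall>n\<ge>m. relatively_compact {x. F m x > g x / real n} \<and>
                  {x. F m x > g x / real n} \<subseteq> {x. real (k n) * G n x \<ge> 1}"
      and \<psi>0: "\<psi> 0 = 0"
      and major: "\<forall>n\<ge>m. ereal (\<psi> ((1 / real m) *\<^sub>R F n)) \<ge> \<phi> (f + (1 / real m) *\<^sub>R F n) - \<phi> f"
    by (insert B[unfolded condition_B_def, rule_format, OF interior F], elim exE conjE, rule that)
  obtain n0 where n0: "2 * \<bar>\<psi> g\<bar> / e \<le> real n0" using real_arch_simple by blast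
  \<comment> \<open>With \<open>n \<ge> 2\<close> each of the two weights is at most \<open>1/2\<close>.\<close>
  define n where "n = max n0 (max m 2)"
  have n: "n \<ge> m" "n \<ge> 2" "n \<ge> 1" and n_e: "2 * \<bar>\<psi> g\<bar> / e \<le> real n" using n0 by (auto simp: n_def)
  have Y0: "0 \<in> Y" and Yg: "g \<in> Y" and YG: "G n \<in> Y"
    and YF: "\<And>j. j \<ge> m \<Longrightarrow> (1 / real m) *\<^sub>R F j \<in> Y"
    using Y n(1) by auto
  define K where "K = real (k n)"
  have K: "K \<ge> 1" using k n(3) by (simp add: K_def)
  define a where "a = \<bar>\<psi> (G n)\<bar> + 1"
  have a: "a > 0" "\<psi> (G n) \<le> a" by (auto simp: a_def)
  define \<eta> where "\<eta> = min (1 / (2 * K)) (e / (2 * K * a))"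
  have \<eta>: "\<eta> > 0" using K a(1) \<open>e > 0\<close> by (auto simp: \<eta>_def)
  have \<eta>1: "\<eta> * K \<le> 1 / 2"
  proof -
    have "\<eta> * K \<le> (1 / (2 * K)) * K" using K by (intro mult_right_mono) (auto simp: \<eta>_def)
    then show ?thesis using K by simp
  qed
  have \<eta>2: "\<eta> * K * \<psi> (G n) \<le> e / 2"
  proof -
    have "\<eta> * K * \<psi> (G n) \<le> \<eta> * K * a" using \<eta> K a by (intro mult_left_mono) auto
    also have "\<dots> = \<eta> * (K * a)" by (rule mult.assoc)
    also have "\<dots> \<le> (e / (2 * K * a)) * (K * a)"
      using K a by (intro mult_right_mono) (auto simp: \<eta>_def)
    also have "\<dots> = e / 2" using K a by (simp add: field_simps)
    finally show ?thesis .
  qed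
  have "\<exists>N. \<forall>j\<ge>N. \<forall>x\<in>closure {x. F m x > g x / real n}. F j x < \<eta>"
    using cpt n(1) \<eta> unfolding relatively_compact_def
    by (intro dini_compact cont FX F_decr F_lim) auto
  then obtain N where N: "\<And>j x. j \<ge> N \<Longrightarrow> x \<in> closure {x. F m x > g x / real n} \<Longrightarrow> F j x < \<eta>"
    by blast
  have "L (F j) \<le> e" if j: "j \<ge> max N m" for j
  proof -
    have j1: "j \<ge> N" "j \<ge> m" "j \<ge> 1" using j m by auto
    let ?u = "1 / (real n * real m)" and ?v = "\<eta> * K / real m"
    have u: "0 \<le> ?u" "?u \<le> 1 / 2"
    proof -
      have "2 * 1 \<le> real n * real m" using n m by (intro mult_mono) auto
      then show "?u \<le> 1 / 2" using n m by (simp add: field_simps)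
    qed simp
    have v: "0 \<le> ?v" "?v \<le> 1 / 2"
    proof -
      have "?v \<le> \<eta> * K / 1" using m \<eta> K by (intro divide_left_mono) auto
      also have "\<dots> \<le> 1 / 2" using \<eta>1 by simp
      finally show "?v \<le> 1 / 2" .
    qed (use \<eta> K in simp)
    have le: "(1 / real m) *\<^sub>R F j \<le> ?u *\<^sub>R g + ?v *\<^sub>R G n"
    proof (rule le_funI)
      fix x
      have g0: "0 \<le> g x" "0 \<le> G n x" using g G n(3) by (auto simp: le_fun_def)
      have "F j x \<le> g x / real n + \<eta> * K * G n x"
      proof (cases "F m x > g x / real n")
        case True
        then have "x \<in> closure {x. F m x > g x / real n}"
          by (intro closure_subset[THEN subsetD]) simp
        then have "F j x < \<eta>" by (rule N[OF j1(1)])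
        moreover have "1 \<le> K * G n x" using cpt n(1) True unfolding K_def by blast
        then have "\<eta> * 1 \<le> \<eta> * (K * G n x)" using \<eta> by (intro mult_left_mono) auto
        moreover have "0 \<le> g x / real n" using g0 by simp
        ultimately show ?thesis by (simp add: mult.assoc)
      next
        case False
        moreover have "F j x \<le> F m x" by (rule F_decr[OF m j1(2)])
        moreover have "0 \<le> \<eta> * K * G n x" using \<eta> K g0 by (intro mult_nonneg_nonneg) auto
        ultimately show ?thesis by linarith
      qed
      then have "F j x / real m \<le> (g x / real n + \<eta> * K * G n x) / real m"
        by (rule divide_right_mono) simp
      then show "((1 / real m) *\<^sub>R F j) x \<le> (?u *\<^sub>R g + ?v *\<^sub>R G n) x"
        by (simp add: add_divide_distrib)
    qed
    have "?u + ?v \<le> 1 / 2 + 1 / 2" by (intro add_mono u v)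
    then have uv: "?u + ?v \<le> 1" by simp
    note conv = convex_on_subconvex[OF \<psi>(1) Y0 Yg YG u(1) v(1) uv]
    have "\<psi> ((1 / real m) *\<^sub>R F j) \<le> \<psi> (?u *\<^sub>R g + ?v *\<^sub>R G n)"
      by (rule mono_onD[OF \<psi>(2) YF[OF j1(2)] conv(1) le])
    also have "\<dots> \<le> ?u * \<psi> g + ?v * \<psi> (G n) + (1 - ?u - ?v) * \<psi> 0"
      by (rule conv(2))
    also have "\<dots> = (\<psi> g / real n + \<eta> * K * \<psi> (G n)) / real m"
      by (simp add: \<psi>0 add_divide_distrib)
    also have "\<dots> \<le> (e / 2 + e / 2) / real m"
    proof (intro divide_right_mono add_mono \<eta>2)
      have "2 * \<bar>\<psi> g\<bar> \<le> real n * e" using n_e \<open>e > 0\<close> by (simp add: field_simps)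
      then have "2 * \<psi> g \<le> real n * e" by linarith
      then show "\<psi> g / real n \<le> e / 2" using n(3) by (simp add: field_simps)
    qed simp
    finally have "\<psi> ((1 / real m) *\<^sub>R F j) \<le> e / real m" by simp
    moreover have "L ((1 / real m) *\<^sub>R F j) \<le> \<psi> ((1 / real m) *\<^sub>R F j)"
      using major j1 FX[OF j1(3)] subspace_scale[OF subspace_X] by (intro L_le_majorant) auto
    ultimately have "L (F j) / real m \<le> e / real m" using L_scale[OF FX[OF j1(3)]] by simp
    then show ?thesis using m by (simp add: divide_le_cancel)
  qed
  then show ?thesis by blast
qed

lemma daniell_functional:
  assumes AB: "condition_A X \<phi> \<or> condition_B X \<phi>"
  shows "daniell_functional X L"
proof
  show "stone_vector_lattice X" by (rule stone)
  show "L (\<lambda>x. g x + h x) = L g + L h" if "g \<in> X" "h \<in> X" for g h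
    using L_add[OF that] by (simp add: plus_fun_def)
  show "L (\<lambda>x. c * h x) = c * L h" if "h \<in> X" for c h
    using L_scale[OF that, of c] by (simp add: scaleR_fun_def)
  show "0 \<le> L h" if "h \<in> X" "\<And>x. 0 \<le> h x" for h
    using that by (intro L_nonneg) (auto simp: le_fun_def)
next
  fix F :: "nat \<Rightarrow> 'a \<Rightarrow> real"
  assume F: "\<And>n. F n \<in> X" "\<And>n x. F (Suc n) x \<le> F n x" "\<And>x. (\<lambda>n. F n x) \<longlonglongrightarrow> 0"
  have F0: "0 \<le> F n x" for n x
    using decseq_ge[OF decseq_SucI F(3), of x n] F(2) by simp
  have "decreases_to_zero_in (nonneg_part X) F"
    using F F0 by (auto simp: decreases_to_zero_in_def nonneg_part_def le_fun_def)
  then have small: "\<exists>N. \<forall>n\<ge>N. L (F n) \<le> e" if "e > 0" for e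
    using AB eventually_small_A eventually_small_B that by blast
  show "(\<lambda>n. L (F n)) \<longlonglongrightarrow> 0"
  proof (rule LIMSEQ_I)
    fix e :: real assume "0 < e"
    then obtain N where "\<forall>n\<ge>N. L (F n) \<le> e / 2" using small[of "e / 2"] by auto
    moreover have "0 \<le> L (F n)" for n using F0 by (intro L_nonneg F) (simp add: le_fun_def)
    ultimately show "\<exists>N. \<forall>n\<ge>N. norm (L (F n) - 0) < e" using \<open>0 < e\<close>
      by (intro exI[of _ N]) fastforce
  qed
qed

end

section \<open>The dual representation\<close>

theorem theorem1p3:
  fixes X :: "('a::topological_space \<Rightarrow> real) set"
    and \<phi> :: "('a \<Rightarrow> real) \<Rightarrow> ereal"
  assumes "stone_vector_lattice X"
    and "\<forall>f\<in>X. continuous_on UNIV f"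
    and "increasing_convex X \<phi>"
    and "condition_A X \<phi> \<or> condition_B X \<phi>"
  shows "\<forall>f\<in>alg_interior_dom X \<phi>. \<exists>\<mu>\<in>ca_plus X.
           \<phi> f = ereal (integral\<^sup>L \<mu> f) - conjugate X \<phi> \<mu> \<and>
           (\<forall>\<nu>\<in>ca_plus X. ereal (integral\<^sup>L \<nu> f) - conjugate X \<phi> \<nu> \<le> \<phi> f)"
proof
  fix f assume f: "f \<in> alg_interior_dom X \<phi>"
  have sub: "subspace X" using assms(1) by (simp add: stone_vector_lattice_def)
  have not_MInf: "\<And>h. h \<in> X \<Longrightarrow> \<phi> h \<noteq> -\<infinity>" and mono: "mono_on X \<phi>"
    and convex: "\<And>g h u v. g \<in> X \<Longrightarrow> h \<in> X \<Longrightarrow> u \<ge> 0 \<Longrightarrow> v \<ge> 0 \<Longrightarrow> u + v = 1 \<Longrightarrow>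
      \<phi> (u *\<^sub>R g + v *\<^sub>R h) \<le> ereal u * \<phi> g + ereal v * \<phi> h"
    using assms(3) unfolding increasing_convex_def by auto
  have fX: "f \<in> X" and "\<phi> f < \<infinity>" using f by (auto simp: alg_interior_dom_def dom_of_def)
  then obtain r where r: "\<phi> f = ereal r" using not_MInf[OF fX] by (cases "\<phi> f") auto
  have "\<exists>t>0. \<phi> (f + t *\<^sub>R h) < \<infinity>" if "h \<in> X" for h
    using f that by (fastforce simp: alg_interior_dom_def dom_of_def)
  then have "\<exists>L. (\<forall>g\<in>X. \<forall>h\<in>X. L (g + h) = L g + L h) \<and>
      (\<forall>h\<in>X. \<forall>c. L (c *\<^sub>R h) = c * L h) \<and> (\<forall>h\<in>X. ereal (r + L h) \<le> \<phi> (f + h))"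
    by (intro convex_subgradient_on[where f = f] sub fX r not_MInf convex)
  then obtain L
    where L: "\<forall>g\<in>X. \<forall>h\<in>X. L (g + h) = L g + L h" "\<forall>h\<in>X. \<forall>c. L (c *\<^sub>R h) = c * L h"
      and below: "\<forall>h\<in>X. ereal (r + L h) \<le> \<phi> (f + h)"
    by blast
  have L_nonneg: "0 \<le> L h" if h: "h \<in> X" "0 \<le> h" for h
  proof -
    have "ereal (r + L ((-1) *\<^sub>R h)) \<le> \<phi> (f + (-1) *\<^sub>R h)"
      using below subspace_scale[OF sub h(1)] by blast
    also have "\<dots> \<le> \<phi> f"
      using h fX subspace_diff[OF sub] by (intro mono_onD[OF mono]) (auto simp: le_fun_def)
    finally have "L ((-1) *\<^sub>R h) \<le> 0" using r by simp
    moreover have "L ((-1) *\<^sub>R h) = -1 * L h" using L(2) h(1) by blast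
    ultimately show ?thesis by simp
  qed
  interpret subgradient_at_interior X \<phi> f r L
    using assms(1,2) f r L L_nonneg below by unfold_locales auto
  interpret D: daniell_functional X L
    by (rule daniell_functional[OF assms(4)])
  let ?\<mu> = "D.representing_measure"
  have conj: "conjugate X \<phi> ?\<mu> = ereal (L f - r)"
    unfolding conjugate_def
  proof (rule antisym)
    show "(SUP h\<in>X. ereal (integral\<^sup>L ?\<mu> h) - \<phi> h) \<le> ereal (L f - r)"
    proof (rule SUP_least)
      fix h assume h: "h \<in> X"
      have "ereal (r + L (h - f)) \<le> \<phi> (f + (h - f))"
        using below subspace_diff[OF sub h fX] by blast
      moreover have "L ((h - f) + f) = L (h - f) + L f"
        using L(1) subspace_diff[OF sub h fX] fX by blast
      ultimately have "ereal (r + L h - L f) \<le> \<phi> h" by simp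
      then show "ereal (integral\<^sup>L ?\<mu> h) - \<phi> h \<le> ereal (L f - r)"
        using D.integral_representing[OF h] not_MInf[OF h] by (cases "\<phi> h") auto
    qed
    have "ereal (L f - r) = ereal (integral\<^sup>L ?\<mu> f) - \<phi> f"
      using D.integral_representing[OF fX] r by simp
    also have "\<dots> \<le> (SUP h\<in>X. ereal (integral\<^sup>L ?\<mu> h) - \<phi> h)" by (rule SUP_upper[OF fX])
    finally show "ereal (L f - r) \<le> (SUP h\<in>X. ereal (integral\<^sup>L ?\<mu> h) - \<phi> h)" .
  qed
  have "ereal (integral\<^sup>L \<nu> f) - conjugate X \<phi> \<nu> \<le> \<phi> f" for \<nu>
  proof -
    have "ereal (integral\<^sup>L \<nu> f) - \<phi> f \<le> conjugate X \<phi> \<nu>"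
      unfolding conjugate_def by (rule SUP_upper[OF fX])
    then show ?thesis using r by (cases "conjugate X \<phi> \<nu>") auto
  qed
  then show "\<exists>\<mu>\<in>ca_plus X. \<phi> f = ereal (integral\<^sup>L \<mu> f) - conjugate X \<phi> \<mu> \<and>
      (\<forall>\<nu>\<in>ca_plus X. ereal (integral\<^sup>L \<nu> f) - conjugate X \<phi> \<nu> \<le> \<phi> f)"
    using D.representing_measure_ca_plus D.integral_representing[OF fX] r
    by (intro bexI[of _ ?\<mu>]) (auto simp: conj)
qed

end
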